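(* Let $\alpha\in\mathbb{Z}_q$. If Alice (with input $\alpha$) and Bob follow Protocol $\mathbf{P}$ described in the context, then the expected trace distance between $|\alpha,b\rangle$ and $|\beta\rangle$, conditioned on Alice not aborting, satisfies $$\mathrm{E}\Big[\big\|\,|\alpha,b\rangle\langle\alpha,b|-|\beta\rangle\langle\beta|\,\big\|_1\ \Big|\ \text{no abort}\Big]\;\le\;\frac{4\pi m\sigma}{q},$$ where the expectation is over the distribution on $(A,t,s,e,f,y)$ defined by Protocol $\mathbf{P}$ and $\|\cdot\|_1$ is the trace norm.
   Context: **Parameters.** $\lambda\ge 1$ is the security parameter; $n,m,q,Q,\sigma,\tau$ are functions of $\lambda$ such that: $\log q$ and $\log\sigma$ are polynomially bounded in $\lambda$ ($\log$ is base 2); $\sigma\ge 1$; $q$ is an odd prime; $Q=\lceil\log q\rceil$; $n=\lambda$; $m=n(2Q+1)$; $\tau=q/(4mQ)$. In addition, $\tau\ge 2m\sigma$. **Notation.** $\mathbb{Z}_q=\{0,\dots,q-1\}$ with arithmetic mod $q$; $|x|=\min\{x,q-x\}$ for $x\in\mathbb{Z}_q$; $\|v\|_\infty=\max_i|v_i|$. For $k\in\mathbb{Z}_q$, $[k]\in\{0,1\}^Q$ is its binary representation, least significant bit first; for $x\in\mathbb{Z}_q^n$, $[x]\in\{0,1\}^{nQ}$ is the concatenation of $[x_1],\dots,[x_n]$. $\oplus$ is bitwise XOR and $z\cdot u$ for bit strings is the inner product mod 2. $x\leftarrow S$ means uniform sampling from the finite set $S$, and $x\leftarrow\chi$ sampling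 from the distribution $\chi$. $G(s)$ ($s>0$) is the discrete Gaussian on $\mathbb{Z}$, with $P(X=x)\propto e^{-x^2/(2s^2)}$; $G(s,t)$ is $G(s)$ conditioned on $|X|\le t$; $\chi^m$ denotes $m$ independent samples. $X,Y,Z$ are the Pauli matrices. **Trapdoors.** $\mathrm{GenTrap}()$ is a fixed probabilistic polynomial-time algorithm and $\mathrm{Invert}$ a fixed deterministic polynomial-time algorithm such that: (1) $\mathrm{GenTrap}()$ returns $(A,t)$ with $A\in\mathbb{Z}_q^{m\times n}$ within statistical distance $nQ2^{-n/2}$ of uniform; (2) for every output $(A,t)$ of $\mathrm{GenTrap}()$, every $s\in\mathbb{Z}_q^n$ and every $e\in\mathbb{Z}_q^m$ with $\|e\|_\infty\le 2\tau$, $\mathrm{Invert}(A,As+e,t)=s$. **Protocol P** (Alice's input: $\alpha\in\mathbb{Z}_q$). 1. Alice samples $(A,t)\leftarrow\mathrm{GenTrap}()$, $s\leftarrow\mathbb{Z}_q^n$, $e\leftarrow G(\sigma,\tau)^m$ (reduced mod $q$), $f\leftarrow\{0,1\}^m$, and sends $(A,v)=(A,As+e)$ and $(a,w)=(f^\top A,f^\top v+\alpha)$ to Bob. 2. Bob prepares the normalized uniform superposition $$|\phi\rangle=\frac{1}{\sqrt{N}}\sum_{x\in\mathbb{Z}_q^n}\ \sum_{c\in\{0,1\}}\ \sum_{g\in\mathbb{Z}_q^m,\ \|g\|_\infty\le\tau}|x\rangle|c\rangle|Ax-cv+g\rangle,$$ where $N$ is the number of triples $(x,c,g)$ in the sum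 and $|x\rangle$ is stored as the $nQ$ qubits $|[x]\rangle$. He measures the third register in the computational basis, obtaining $y\in\mathbb{Z}_q^m$ and an $(nQ+1)$-qubit state $|\psi\rangle$ on the first two registers. With $r_{(i-1)Q+j}=2^j\pi a_i/q$ for $1\le i\le n$, $1\le j\le Q$, and $r=2\pi w/q$, for each $k\in\{1,\dots,nQ\}$ he measures the $k$-th qubit of $|\psi\rangle$ in the eigenbasis of $(\cos r_k)X+(\sin r_k)Y$, obtaining outcome $(-1)^{u_k}$. If $|\psi'\rangle$ is the state of the last (unmeasured) qubit, Bob prepares $|\beta\rangle=\begin{bmatrix}1&0\\0&e^{ir}\end{bmatrix}|\psi'\rangle$. He sends $y$ and $u\in\{0,1\}^{nQ}$ to Alice. 3. Alice aborts unless $y$ belongs to $\{Ax+g: x\in\mathbb{Z}_q^n,\ g\in\mathbb{Z}_q^m,\ \|g\|_\infty\le\tau\}\cap\{Ax-v+g: x\in\mathbb{Z}_q^n,\ g\in\mathbb{Z}_q^m,\ \|g\|_\infty\le\tau\}$. If she does not abort, she computes $x_0=\mathrm{Invert}(A,y,t)$, $x_1=x_0+s\in\mathbb{Z}_q^n$, $z=[x_0]\oplus[x_1]$, $b=z\cdot u\in\{0,1\}$, and outputs the description of $$|\alpha,b\rangle=Z^b\,\tfrac{1}{\sqrt2}\big(|0\rangle+e^{2\pi i\alpha/q}|1\rangle\big).$$ *)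

theory Defs
  imports
    "HOL-Probability.Probability_Mass_Function"
    "HOL-Computational_Algebra.Primes"
    "Jordan_Normal_Form.Matrix"
    "Jordan_Normal_Form.Char_Poly"
    "Jordan_Normal_Form.Schur_Decomposition"
begin

hide_type (open) Finite_Cartesian_Product.vec
hide_const (open) Finite_Cartesian_Product.vec
unbundle no vec_syntax
unbundle no inner_syntax

subsection \<open>Arithmetic modulo \<open>q\<close>\<close>

text \<open>
  The ring of integers mod \<open>q\<close> is represented by the integers in \<open>{0..<q}\<close>; vectors and
  matrices over it are integer vectors and matrices with such entries, and a computation
  mod \<open>q\<close> is a computation over the integers followed by an entrywise reduction.
\<close>

definition Zvec :: "nat \<Rightarrow> nat \<Rightarrow> int vec set" where
  "Zvec q d = {v \<in> carrier_vec d. \<forall>i<d. v $ i \<in> {0..<int q}}"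

definition Zmat :: "nat \<Rightarrow> nat \<Rightarrow> nat \<Rightarrow> int mat set" where
  "Zmat q k d = {M \<in> carrier_mat k d. \<forall>i<k. \<forall>j<d. M $$ (i, j) \<in> {0..<int q}}"

definition vmod :: "int vec \<Rightarrow> nat \<Rightarrow> int vec" (infixl "vmod" 60) where
  "v vmod q = map_vec (\<lambda>x. x mod int q) v"

definition zabs :: "nat \<Rightarrow> int \<Rightarrow> int" where
  "zabs q x = min x (int q - x)"

definition zinf_norm :: "nat \<Rightarrow> int vec \<Rightarrow> int" where
  "zinf_norm q v = Max ((\<lambda>i. zabs q (v $ i)) ` {..<dim_vec v})"

definition short_vecs :: "nat \<Rightarrow> nat \<Rightarrow> real \<Rightarrow> int vec set" where
  "short_vecs q d t = {g \<in> Zvec q d. real_of_int (zinf_norm q g) \<le> t}"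

subsection \<open>Bit strings\<close>

definition bitstrings :: "nat \<Rightarrow> bool list set" where
  "bitstrings N = {bs. length bs = N}"

text \<open>Least significant bit first.\<close>

definition binary :: "nat \<Rightarrow> int \<Rightarrow> bool list" where
  "binary Q k = map (\<lambda>j. bit k j) [0..<Q]"

definition binary_vec :: "nat \<Rightarrow> int vec \<Rightarrow> bool list" where
  "binary_vec Q x = concat (map (binary Q) (list_of_vec x))"

definition bxor :: "bool list \<Rightarrow> bool list \<Rightarrow> bool list" where
  "bxor xs ys = map2 (\<noteq>) xs ys"

definition bdot :: "bool list \<Rightarrow> bool list \<Rightarrow> nat" where
  "bdot xs ys = (\<Sum>k<length xs. of_bool (xs ! k) * of_bool (ys ! k)) mod 2"

subsection \<open>Distributions\<close>

definition stat_dist :: "'a pmf \<Rightarrow> 'a pmf \<Rightarrow> real" where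
  "stat_dist P R = (1 / 2) * (\<Sum>\<^sub>\<infinity>x. \<bar>pmf P x - pmf R x\<bar>)"

definition gaussian_weight :: "real \<Rightarrow> int \<Rightarrow> real" where
  "gaussian_weight s x = exp (- (real_of_int x)\<^sup>2 / (2 * s\<^sup>2))"

definition discrete_gaussian :: "real \<Rightarrow> int pmf" where
  "discrete_gaussian s =
     embed_pmf (\<lambda>x. gaussian_weight s x / (\<Sum>\<^sub>\<infinity>z. gaussian_weight s z))"

definition truncated_gaussian :: "real \<Rightarrow> real \<Rightarrow> int pmf" where
  "truncated_gaussian s t = cond_pmf (discrete_gaussian s) {x. \<bar>real_of_int x\<bar> \<le> t}"

definition poly_bounded :: "(nat \<Rightarrow> real) \<Rightarrow> bool" where
  "poly_bounded f \<longleftrightarrow> (\<exists>p :: real poly. \<forall>l\<ge>1. f l \<le> poly p (real l))"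

subsection \<open>Quantum states and measurements\<close>

definition pauli_X :: "complex mat" where
  "pauli_X = mat_of_rows_list 2 [[0, 1], [1, 0]]"

definition pauli_Y :: "complex mat" where
  "pauli_Y = mat_of_rows_list 2 [[0, - \<i>], [\<i>, 0]]"

definition pauli_Z :: "complex mat" where
  "pauli_Z = mat_of_rows_list 2 [[1, 0], [0, - 1]]"

definition phase_gate :: "real \<Rightarrow> complex mat" where
  "phase_gate r = mat_of_rows_list 2 [[1, 0], [0, exp (\<i> * complex_of_real r)]]"

definition xy_observable :: "real \<Rightarrow> complex mat" where
  "xy_observable r = complex_of_real (cos r) \<cdot>\<^sub>m pauli_X + complex_of_real (sin r) \<cdot>\<^sub>m pauli_Y"

text \<open>
  A normalized eigenvector, which for a simple eigenvalue is determined up to a global phase.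
\<close>

definition eigenket :: "complex mat \<Rightarrow> complex \<Rightarrow> complex vec" where
  "eigenket M \<mu> = (SOME v. eigenvector M v \<mu> \<and> v \<bullet>c v = 1)"

lemma eigenket_xy_observable:
  fixes r :: real and u :: bool
  defines "\<mu> \<equiv> (- 1) ^ of_bool u :: complex"
  shows "eigenvector (xy_observable r) (eigenket (xy_observable r) \<mu>) \<mu>"
    and "eigenket (xy_observable r) \<mu> \<bullet>c eigenket (xy_observable r) \<mu> = 1"
proof -
  define M where "M = xy_observable r"
  have M: "M \<in> carrier_mat 2 2"
    "M $$ (0, 0) = 0" "M $$ (0, Suc 0) = cnj (cis r)"
    "M $$ (Suc 0, 0) = cis r" "M $$ (Suc 0, Suc 0) = 0"
    by (auto simp: M_def xy_observable_def pauli_X_def pauli_Y_def mat_of_rows_list_def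
        complex_eq_iff)
  define v :: "complex vec" where
    "v = vec 2 (\<lambda>i. (if i = 0 then 1 else \<mu> * cis r) / complex_of_real (sqrt 2))"
  have \<mu>: "\<mu> * \<mu> = 1" "cnj \<mu> = \<mu>"
    by (auto simp: \<mu>_def)
  have cc: "cis r * cnj (cis r) = 1"
    by (simp add: complex_eq_iff flip: power2_eq_square)
  have s2: "complex_of_real (sqrt 2) * complex_of_real (sqrt 2) = 2"
    by (simp flip: of_real_mult)
  have "M *\<^sub>v v = \<mu> \<cdot>\<^sub>v v"
  proof (rule eq_vecI)
    fix i assume "i < dim_vec (\<mu> \<cdot>\<^sub>v v)"
    then have "i = 0 \<or> i = Suc 0" by (auto simp: v_def)
    then show "(M *\<^sub>v v) $ i = (\<mu> \<cdot>\<^sub>v v) $ i"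
      using M \<mu>(1) cc
      by (auto simp: scalar_prod_def v_def numeral_2_eq_2 ac_simps simp flip: mult.assoc)
  qed (use M in \<open>auto simp: v_def\<close>)
  moreover have "v \<bullet>c v = 1"
  proof -
    have "\<mu> * cis r * (\<mu> * cnj (cis r)) = (\<mu> * \<mu>) * (cis r * cnj (cis r))"
      by (simp only: ac_simps)
    then have "\<mu> * cis r * (\<mu> * cnj (cis r)) = 1"
      using \<mu>(1) cc by simp
    then show ?thesis
      using \<mu>(2) s2 by (simp add: scalar_prod_def v_def numeral_2_eq_2)
  qed
  moreover from this have "v \<noteq> 0\<^sub>v 2" by auto
  ultimately have "eigenvector M v \<mu> \<and> v \<bullet>c v = 1"
    using M by (auto simp: eigenvector_def v_def)
  then have "eigenvector M (eigenket M \<mu>) \<mu> \<and> eigenket M \<mu> \<bullet>c eigenket M \<mu> = 1"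
    unfolding eigenket_def by (rule someI)
  then show "eigenvector (xy_observable r) (eigenket (xy_observable r) \<mu>) \<mu>"
    and "eigenket (xy_observable r) \<mu> \<bullet>c eigenket (xy_observable r) \<mu> = 1"
    by (auto simp: M_def)
qed

definition ketbra :: "complex vec \<Rightarrow> complex mat" where
  "ketbra v = mat (dim_vec v) (dim_vec v) (\<lambda>(i, j). v $ i * cnj (v $ j))"

text \<open>
  The trace norm as the sum of the singular values, that is of the square roots of the
  eigenvalues of \<open>M\<^sup>* M\<close>, counted with algebraic multiplicity.
\<close>

definition trace_norm :: "complex mat \<Rightarrow> real" where
  "trace_norm M =
     (let p = char_poly (mat_adjoint M * M)
      in \<Sum>\<mu> | poly p \<mu> = 0. real (Polynomial.order \<mu> p) * sqrt (Re \<mu>))"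

text \<open>
  A pure state of a system with a finite computational basis \<open>B\<close> is given by its
  amplitudes, a function on \<open>B\<close>.  A measurement with outcome set \<open>O'\<close> is described by
  the family of unnormalized residual states \<open>R o\<close> on the unmeasured registers; Born's
  rule gives outcome \<open>o\<close> the probability \<open>sq_norm B (R o)\<close>, and the residual state is
  then normalized.
\<close>

definition sq_norm :: "'b set \<Rightarrow> ('b \<Rightarrow> complex) \<Rightarrow> real" where
  "sq_norm B \<psi> = (\<Sum>b\<in>B. (cmod (\<psi> b))\<^sup>2)"

definition measurement ::
  "'b set \<Rightarrow> 'o set \<Rightarrow> ('o \<Rightarrow> 'b \<Rightarrow> complex) \<Rightarrow> ('o \<times> ('b \<Rightarrow> complex)) pmf" where
  "measurement B O' R =
     map_pmf (\<lambda>o'. (o', \<lambda>b. R o' b / complex_of_real (sqrt (sq_norm B (R o')))))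
       (embed_pmf (\<lambda>o'. if o' \<in> O' then sq_norm B (R o') else 0))"

text \<open>
  The residual amplitudes \<open>(\<langle>\<eta>\<^sub>0| \<otimes> ... \<otimes> \<langle>\<eta>\<^bsub>N-1\<^esub>| \<otimes> I) |\<psi>\<rangle>\<close> of the last qubit, where
  \<open>\<eta>\<^sub>k\<close> is the eigenvector of \<open>xy_observable (r k)\<close> with eigenvalue \<open>(-1)^(u ! k)\<close>.
\<close>

definition measure_qubits_residual ::
  "nat \<Rightarrow> (nat \<Rightarrow> real) \<Rightarrow> (bool list \<times> bool \<Rightarrow> complex) \<Rightarrow> bool list \<Rightarrow> bool \<Rightarrow> complex" where
  "measure_qubits_residual N r \<psi> u c =
     (\<Sum>bs\<in>bitstrings N.
        (\<Prod>k<N. cnj (eigenket (xy_observable (r k)) ((- 1) ^ of_bool (u ! k)) $ of_bool (bs ! k)))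
          * \<psi> (bs, c))"

subsection \<open>The protocol\<close>

definition bob_triples :: "nat \<Rightarrow> nat \<Rightarrow> nat \<Rightarrow> real \<Rightarrow> (int vec \<times> bool \<times> int vec) set" where
  "bob_triples q n m \<tau> = Zvec q n \<times> UNIV \<times> short_vecs q m \<tau>"

definition bob_phi :: "nat \<Rightarrow> nat \<Rightarrow> nat \<Rightarrow> nat \<Rightarrow> real \<Rightarrow> int mat \<Rightarrow> int vec \<Rightarrow>
    bool list \<times> bool \<times> int vec \<Rightarrow> complex" where
  "bob_phi q Q n m \<tau> A v lbl =
     (\<Sum>(x, c, g)\<in>bob_triples q n m \<tau>.
        if lbl = (binary_vec Q x, c, (A *\<^sub>v x - of_bool c \<cdot>\<^sub>v v + g) vmod q) then 1 else 0)
     / complex_of_real (sqrt (real (card (bob_triples q n m \<tau>))))"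

text \<open>
  With zero-based \<open>k = i * Q + j\<close>, bit \<open>j\<close> of coordinate \<open>i\<close> has weight \<open>2^j\<close>, and the angle
  is \<open>2^(j+1) * pi * a\<^sub>i / q\<close>.
\<close>

definition bob_angle :: "nat \<Rightarrow> nat \<Rightarrow> int vec \<Rightarrow> nat \<Rightarrow> real" where
  "bob_angle q Q a k = 2 ^ (k mod Q + 1) * pi * real_of_int (a $ (k div Q)) / real q"

definition bob :: "nat \<Rightarrow> nat \<Rightarrow> nat \<Rightarrow> nat \<Rightarrow> real \<Rightarrow> int mat \<Rightarrow> int vec \<Rightarrow> int vec \<Rightarrow> int \<Rightarrow>
    (int vec \<times> bool list \<times> complex vec) pmf" where
  "bob q Q n m \<tau> A v a w = do {
     (y, \<psi>) \<leftarrow> measurement (bitstrings (n * Q) \<times> UNIV) (Zvec q m)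
                  (\<lambda>y (bs, c). bob_phi q Q n m \<tau> A v (bs, c, y));
     (u, \<psi>') \<leftarrow> measurement UNIV (bitstrings (n * Q))
                  (measure_qubits_residual (n * Q) (bob_angle q Q a) \<psi>);
     let \<beta> = phase_gate (2 * pi * real_of_int w / real q) *\<^sub>v vec 2 (\<lambda>i. \<psi>' (i = 1));
     return_pmf (y, u, \<beta>)
   }"

definition protocol_P :: "nat \<Rightarrow> nat \<Rightarrow> nat \<Rightarrow> nat \<Rightarrow> real \<Rightarrow> real \<Rightarrow> (int mat \<times> 't) pmf \<Rightarrow> int \<Rightarrow>
    (int mat \<times> 't \<times> int vec \<times> int vec \<times> int vec \<times> int vec \<times> bool list \<times> complex vec) pmf" where
  "protocol_P q Q n m \<sigma> \<tau> gentrap \<alpha> = do {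
     (A, t) \<leftarrow> gentrap;
     s \<leftarrow> pmf_of_set (Zvec q n);
     e \<leftarrow> map_pmf (\<lambda>es. vec_of_list es vmod q) (replicate_pmf m (truncated_gaussian \<sigma> \<tau>));
     f \<leftarrow> pmf_of_set (Zvec 2 m);
     let v = (A *\<^sub>v s + e) vmod q;
     let a = (transpose_mat A *\<^sub>v f) vmod q;
     let w = (f \<bullet> v + \<alpha>) mod int q;
     (y, u, \<beta>) \<leftarrow> bob q Q n m \<tau> A v a w;
     return_pmf (A, t, s, e, f, y, u, \<beta>)
   }"

definition alice_no_abort ::
  "nat \<Rightarrow> nat \<Rightarrow> nat \<Rightarrow> real \<Rightarrow> int mat \<Rightarrow> int vec \<Rightarrow> int vec \<Rightarrow> bool" where
  "alice_no_abort q n m \<tau> A v y \<longleftrightarrow>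
     y \<in> {(A *\<^sub>v x + g) vmod q | x g. x \<in> Zvec q n \<and> g \<in> short_vecs q m \<tau>} \<inter>
         {(A *\<^sub>v x - v + g) vmod q | x g. x \<in> Zvec q n \<and> g \<in> short_vecs q m \<tau>}"

definition no_abort :: "nat \<Rightarrow> nat \<Rightarrow> nat \<Rightarrow> real \<Rightarrow>
    (int mat \<times> 't \<times> int vec \<times> int vec \<times> int vec \<times> int vec \<times> bool list \<times> complex vec) set" where
  "no_abort q n m \<tau> =
     {(A, t, s, e, f, y, u, \<beta>). alice_no_abort q n m \<tau> A ((A *\<^sub>v s + e) vmod q) y}"

definition alice_bit :: "nat \<Rightarrow> nat \<Rightarrow> (int mat \<Rightarrow> int vec \<Rightarrow> 't \<Rightarrow> int vec) \<Rightarrow>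
    int mat \<Rightarrow> 't \<Rightarrow> int vec \<Rightarrow> int vec \<Rightarrow> bool list \<Rightarrow> nat" where
  "alice_bit q Q invert A t s y u =
     (let x0 = invert A y t;
          x1 = (x0 + s) vmod q;
          z = bxor (binary_vec Q x0) (binary_vec Q x1)
      in bdot z u)"

definition alice_ket :: "nat \<Rightarrow> int \<Rightarrow> nat \<Rightarrow> complex vec" where
  "alice_ket q \<alpha> b =
     (pauli_Z ^\<^sub>m b) *\<^sub>v
       (complex_of_real (1 / sqrt 2) \<cdot>\<^sub>v
          vec_of_list [1, exp (2 * pi * \<i> * of_int \<alpha> / of_nat q)])"

end

(* Bob's superposition over x and c collapses, for an outcome y that Alice accepts, to the two
   branches x_0 (c = 0) and x_1 = x_0 + s (c = 1), because trapdoor inversion makes the decoding of y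
   unique.  Measuring the qubits of x in the XY-plane turns the branches into phases, so that the
   last qubit is (|0> + rho |1>) / sqrt 2 with rho = (-1)^b e^(2 pi i (alpha + <f, e>) / q), up to a
   global phase.  The trace distance to |alpha, b> is thus at most 2 pi |<f, e>| / q, hence at most
   2 pi / q times the sum of the |e_i|.

   Given e, each accepted y has probability 2 / N, and counting them shows that Alice accepts with
   probability prod_i (1 - |e_i| / M), where M = 2 floor(tau) + 1.  Conditioning on acceptance
   therefore reweights the independent coordinates of e by the decreasing factor 1 - |x| / M, which
   only lowers the mean of |e_i|; and that mean is at most 2 sigma before reweighting. *)

theory Submission
  imports Defs "HOL-Number_Theory.Cong"
begin

text \<open>The obstacle is the conditioning: acceptance favours small noise, so the mean of
  \<open>|e_i|\<close> must be bounded under the tilted law, not under the sampled one. This works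
  because the acceptance probability is an exact product over the coordinates and depends on
  \<open>e\<close> alone, so \<open>A\<close>, \<open>s\<close> and \<open>f\<close> integrate out
  and independence survives the tilt. Everything is kept unnormalized, error times acceptance
  against acceptance, with a single division at the end. The phase comes out right because
  \<open>a = A^T f\<close>: the measured bits contribute \<open><a, x_0> - <a, x_1>\<close>, which
  is \<open>- <f, A s>\<close> mod q and cancels that term of \<open>w\<close>. In the constant,
  \<open>2 pi / q\<close> turns residues into angles, \<open>m\<close> counts the coordinates (the
  entries of \<open>f\<close> are 0 or 1) and \<open>2 \<sigma>\<close> bounds each mean; the factor
  2 leaves room for a crude discrete estimate of the second moment, where
  \<open>\<sigma> >= 1\<close> enters. Inversion must tolerate \<open>2 \<tau>\<close> because the
  branch \<open>c = 1\<close> carries the difference of two \<open>\<tau>\<close>-short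
  vectors.\<close>

subsection \<open>Discrete Gaussians\<close>

lemma gaussian_weight_pos: "gaussian_weight s x > 0"
  and gaussian_weight_minus: "gaussian_weight s (- x) = gaussian_weight s x"
  and gaussian_weight_0: "gaussian_weight s 0 = 1"
  by (auto simp: gaussian_weight_def)

text \<open>Since \<open>n <= n^2\<close> on the naturals, the weights lie below a geometric series.
  Symmetry covers the negative integers, indexed by \<open>- int (Suc n)\<close> so that 0 occurs
  once.\<close>

lemma summable_on_gaussian_weight:
  assumes "s > 0"
  shows "gaussian_weight s summable_on UNIV"
proof -
  have "summable (\<lambda>n. exp (- 1 / (2 * s\<^sup>2)) ^ n)"
    using assms by (intro summable_geometric) auto
  then have "summable (\<lambda>n. gaussian_weight s (int n))"
  proof (rule summable_comparison_test[rotated], intro exI allI impI)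
    fix n :: nat
    have "real n \<le> (real n)\<^sup>2" by (cases n) (auto simp: power2_eq_square)
    then have "- (real n)\<^sup>2 / (2 * s\<^sup>2) \<le> real n * (- 1 / (2 * s\<^sup>2))"
      using assms by (simp add: field_simps)
    then show "norm (gaussian_weight s (int n)) \<le> exp (- 1 / (2 * s\<^sup>2)) ^ n"
      by (simp add: gaussian_weight_def flip: exp_of_nat_mult)
  qed
  then have nat: "(\<lambda>n. gaussian_weight s (int n)) summable_on UNIV"
    by (rule summable_nonneg_imp_summable_on) (auto simp: gaussian_weight_def)
  then have "(\<lambda>n. gaussian_weight s (int n)) summable_on range Suc"
    using summable_on_subset_banach by blast
  then have "(\<lambda>n. gaussian_weight s (- int (Suc n))) summable_on UNIV"
    unfolding gaussian_weight_minus by (subst (asm) summable_on_reindex) (auto simp: o_def)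
  then have "gaussian_weight s summable_on range (\<lambda>n. - int (Suc n))"
    by (subst summable_on_reindex) (auto simp: o_def inj_def)
  moreover have "gaussian_weight s summable_on range int"
    using nat by (subst summable_on_reindex) (auto simp: o_def)
  ultimately have "gaussian_weight s summable_on (range int \<union> range (\<lambda>n. - int (Suc n)))"
    by (intro summable_on_Un_disjoint) auto
  moreover have "range int \<union> range (\<lambda>n. - int (Suc n)) = UNIV"
  proof (intro UNIV_eq_I[symmetric])
    show "x \<in> range int \<union> range (\<lambda>n. - int (Suc n))" for x
      by (cases x rule: int_cases) auto
  qed
  ultimately show ?thesis by simp
qed

text \<open>\<open>embed_pmf\<close> has the intended probabilities only if the weights are
  nonnegative with integral 1; this is checked here.\<close>

lemma pmf_discrete_gaussian:
  assumes "s > 0"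
  shows "pmf (discrete_gaussian s) x = gaussian_weight s x / (\<Sum>\<^sub>\<infinity>z. gaussian_weight s z)"
    and "(\<Sum>\<^sub>\<infinity>z. gaussian_weight s z) > 0"
proof -
  let ?g = "gaussian_weight s" and ?Z = "\<Sum>\<^sub>\<infinity>z. gaussian_weight s z"
  have sum: "?g summable_on UNIV" by (rule summable_on_gaussian_weight[OF assms])
  have "?g 0 \<le> ?Z"
    using finite_sum_le_infsum[OF sum, of "{0}"] by (auto intro: less_imp_le gaussian_weight_pos)
  then show Z: "?Z > 0" by (simp add: gaussian_weight_0)
  \<comment> \<open>\<open>infsetsum\<close> links the \<open>infsum\<close> of the definition to
    the integral over \<open>count_space\<close>.\<close>
  have abs: "Infinite_Set_Sum.abs_summable_on ?g UNIV"
    unfolding abs_summable_equivalent[symmetric] using sum by (simp add: abs_of_pos[OF gaussian_weight_pos])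
  have "(\<integral>\<^sup>+x. ennreal (?g x) \<partial>count_space UNIV) = ennreal ?Z"
    using nn_integral_conv_infsetsum[OF abs] infsetsum_infsum[OF abs]
    by (simp add: less_imp_le[OF gaussian_weight_pos])
  moreover have "ennreal (?g x / ?Z) = ennreal (?g x) * ennreal (1 / ?Z)" for x
    using Z by (simp add: less_imp_le[OF gaussian_weight_pos] flip: ennreal_mult)
  ultimately have "(\<integral>\<^sup>+x. ennreal (?g x / ?Z) \<partial>count_space UNIV) = ennreal ?Z * ennreal (1 / ?Z)"
    by (simp add: nn_integral_multc)
  also have "\<dots> = 1"
    using Z by (subst ennreal_mult[symmetric]) auto
  finally have "(\<integral>\<^sup>+x. ennreal (?g x / ?Z) \<partial>count_space UNIV) = 1" .
  then show "pmf (discrete_gaussian s) x = ?g x / ?Z"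
    unfolding discrete_gaussian_def using Z
    by (intro pmf_embed_pmf) (auto intro!: divide_nonneg_pos less_imp_le[OF gaussian_weight_pos])
qed

text \<open>The constant \<open>c\<close> absorbs both normalizations, of the Gaussian and of the
  conditioning. Later inequalities are homogeneous in it, so its exact value is left open.\<close>

lemma nn_integral_truncated_gaussian:
  assumes "s > 0" "t \<ge> 0"
  obtains c where "c > 0" and "set_pmf (truncated_gaussian s t) = {- \<lfloor>t\<rfloor>..\<lfloor>t\<rfloor>}" and
    "\<And>f. (\<integral>\<^sup>+x. ennreal (f x) \<partial>truncated_gaussian s t) =
      (\<Sum>x = - \<lfloor>t\<rfloor>..\<lfloor>t\<rfloor>. ennreal (f x) * ennreal (c * gaussian_weight s x))"
proof -
  let ?P = "discrete_gaussian s" and ?I = "{x. \<bar>real_of_int x\<bar> \<le> t}"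
  let ?Z = "\<Sum>\<^sub>\<infinity>z. gaussian_weight s z"
  have I: "?I = {- \<lfloor>t\<rfloor>..\<lfloor>t\<rfloor>}"
    by (auto simp: abs_le_iff le_floor_iff) linarith+
  have supp: "set_pmf ?P = UNIV"
    using pmf_discrete_gaussian[OF assms(1)] by (auto simp: set_pmf_eq gaussian_weight_def)
  then have ne: "set_pmf ?P \<inter> ?I \<noteq> {}" using assms(2) by (auto intro!: exI[of _ 0])
  have "measure ?P ?I > 0"
    using measure_measure_pmf_not_zero[OF ne] by (simp add: zero_less_measure_iff)
  define c where "c = 1 / (?Z * measure ?P ?I)"
  show thesis
  proof
    show "c > 0" using pmf_discrete_gaussian(2)[OF assms(1)] \<open>measure ?P ?I > 0\<close> by (simp add: c_def)
    show set: "set_pmf (truncated_gaussian s t) = {- \<lfloor>t\<rfloor>..\<lfloor>t\<rfloor>}"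
      using ne I supp by (simp add: truncated_gaussian_def)
    show "(\<integral>\<^sup>+x. ennreal (f x) \<partial>truncated_gaussian s t) =
      (\<Sum>x = - \<lfloor>t\<rfloor>..\<lfloor>t\<rfloor>. ennreal (f x) * ennreal (c * gaussian_weight s x))" for f
      using pmf_cond[OF ne] pmf_discrete_gaussian(1)[OF assms(1)] unfolding I
      by (subst nn_integral_measure_pmf_finite)
        (auto simp: set truncated_gaussian_def I c_def set[unfolded truncated_gaussian_def I]
          intro!: sum.cong)
  qed
qed

section \<open>Moment bounds for the truncated Gaussian\<close>

lemma sum_symmetric_int:
  fixes f :: "int \<Rightarrow> real"
  assumes "\<And>x. f (- x) = f x"
  shows "(\<Sum>x = - int T..int T. f x) = f 0 + 2 * (\<Sum>k<T. f (int (Suc k)))"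
proof (induction T)
  case (Suc T)
  have "{- int (Suc T)..int (Suc T)} = insert (- int (Suc T)) (insert (int (Suc T)) {- int T..int T})"
    by auto
  then show ?case using Suc assms[of "int (Suc T)"] by simp
qed simp

text \<open>A discrete form of \<open>g' = - x g / s^2\<close>: consecutive weights have ratio
  \<open>exp ((2 k + 1) / (2 s^2))\<close>, which is bounded below by the first two terms of the
  series.\<close>

lemma gaussian_weight_step:
  assumes "s > 0"
  shows "(2 * real k + 1) * gaussian_weight s (int (Suc k))
    \<le> 2 * s\<^sup>2 * (gaussian_weight s (int k) - gaussian_weight s (int (Suc k)))"
proof -
  let ?d = "(2 * real k + 1) / (2 * s\<^sup>2)"
  have "- (real k)\<^sup>2 / (2 * s\<^sup>2) = - (real (Suc k))\<^sup>2 / (2 * s\<^sup>2) + ?d"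
    using assms by (simp add: field_simps power2_eq_square)
  then have "gaussian_weight s (int k) = gaussian_weight s (int (Suc k)) * exp ?d"
    unfolding gaussian_weight_def by (simp flip: exp_add)
  moreover have "gaussian_weight s (int (Suc k)) * (1 + ?d) \<le> gaussian_weight s (int (Suc k)) * exp ?d"
    by (intro mult_left_mono exp_ge_add_one_self) (simp add: gaussian_weight_def)
  ultimately show ?thesis using assms by (simp add: field_simps)
qed

text \<open>Summation by parts against \<open>gaussian_weight_step\<close>.\<close>

lemma gaussian_second_moment_partial:
  assumes "s > 0"
  shows "(\<Sum>k<T. real (Suc k) * ((2 * real k + 1) * gaussian_weight s (int (Suc k))))
    \<le> 2 * s\<^sup>2 * (\<Sum>k<T. gaussian_weight s (int k))"
proof -
  have "(\<Sum>k<T. real (Suc k) * ((2 * real k + 1) * gaussian_weight s (int (Suc k))))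
    \<le> 2 * s\<^sup>2 * ((\<Sum>k<T. gaussian_weight s (int k)) - real T * gaussian_weight s (int T))"
  proof (induction T)
    case (Suc T)
    have "real (Suc T) * ((2 * real T + 1) * gaussian_weight s (int (Suc T)))
       \<le> real (Suc T) * (2 * s\<^sup>2 * (gaussian_weight s (int T) - gaussian_weight s (int (Suc T))))"
      by (intro mult_left_mono gaussian_weight_step assms) auto
    with Suc show ?case by (simp add: algebra_simps)
  qed simp
  also have "\<dots> \<le> 2 * s\<^sup>2 * (\<Sum>k<T. gaussian_weight s (int k))"
    by (intro mult_left_mono) (auto simp: gaussian_weight_def)
  finally show ?thesis .
qed

text \<open>For the mean \<open>mu = S 1 / S 0\<close>, the second moment estimate and
  Cauchy-Schwarz give \<open>mu^2 <= 2 s^2 + mu / 2\<close>, which forces \<open>mu <= 2 s\<close>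
  when \<open>s >= 1\<close>. The other conclusions feed the tilting argument.\<close>

lemma gaussian_first_moment:
  fixes s :: real and T :: nat
  assumes "s \<ge> 1"
  defines "S \<equiv> \<lambda>j. \<Sum>x = - int T..int T. \<bar>real_of_int x\<bar> ^ j * gaussian_weight s x"
  shows "S 1 \<le> 2 * s * S 0" and "S 1 ^ 2 \<le> S 2 * S 0" and "S 0 > 0"
    and "S 1 \<le> real T * S 0"
proof -
  let ?g = "gaussian_weight s"
  have g: "?g x > 0" for x by (simp add: gaussian_weight_def)
  let ?A = "\<lambda>j. \<Sum>k<T. real (Suc k) ^ j * ?g (int (Suc k))"
  have sym: "\<bar>real_of_int (- x)\<bar> ^ j * ?g (- x) = \<bar>real_of_int x\<bar> ^ j * ?g x" for x j
    by (simp add: gaussian_weight_def)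
  have S: "S j = 0 ^ j + 2 * ?A j" for j
    unfolding S_def
    by (subst sum_symmetric_int[where f = "\<lambda>x. \<bar>real_of_int x\<bar> ^ j * ?g x", OF sym])
       (simp add: gaussian_weight_0)
  have A0: "?A j \<ge> 0" for j using g by (intro sum_nonneg) (auto intro: less_imp_le)
  show pos: "S 0 > 0" using A0[of 0] by (simp add: S)
  show CS: "S 1 ^ 2 \<le> S 2 * S 0"
  proof -
    have "(\<Sum>x = - int T..int T. (\<bar>real_of_int x\<bar> * sqrt (?g x)) * sqrt (?g x))\<^sup>2
      \<le> (\<Sum>x = - int T..int T. (\<bar>real_of_int x\<bar> * sqrt (?g x))\<^sup>2) *
         (\<Sum>x = - int T..int T. (sqrt (?g x))\<^sup>2)"
      by (rule Cauchy_Schwarz_ineq_sum)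
    then show ?thesis
      using g by (simp add: S_def mult.assoc power_mult_distrib less_imp_le)
  qed
  have "\<bar>real_of_int x\<bar> ^ 1 * ?g x \<le> real T * (\<bar>real_of_int x\<bar> ^ 0 * ?g x)" if "x \<in> {- int T..int T}" for x
    using that g[of x] by (auto intro!: mult_right_mono)
  then show "S 1 \<le> real T * S 0"
    unfolding S_def sum_distrib_left by (rule sum_mono)
  \<comment> \<open>The second moment estimate is in terms of the weights at \<open>0..T-1\<close>;
    their sum is compared with \<open>S 0 = 1 + 2 * ?A 0\<close>.\<close>
  have "(\<Sum>k<T. ?g (int k)) \<le> 1 + ?A 0"
  proof (cases T)
    case (Suc T')
    have "(\<Sum>k<T'. ?g (int (Suc k))) \<le> ?A 0"
      unfolding Suc using g[of "int (Suc T')"] by simp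
    then show ?thesis
      unfolding Suc by (subst sum.lessThan_Suc_shift) (simp add: gaussian_weight_def)
  qed simp
  then have "2 * s\<^sup>2 * (\<Sum>k<T. ?g (int k)) \<le> 2 * s\<^sup>2 * S 0"
    using A0[of 0] by (intro mult_left_mono) (auto simp: S)
  moreover have "2 * ?A 2 - ?A 1 =
      (\<Sum>k<T. real (Suc k) * ((2 * real k + 1) * gaussian_weight s (int (Suc k))))"
    by (simp add: sum_distrib_left flip: sum_subtractf)
       (intro sum.cong refl, simp add: algebra_simps power2_eq_square)
  ultimately have "2 * ?A 2 - ?A 1 \<le> 2 * s\<^sup>2 * S 0"
    using gaussian_second_moment_partial[of s T] assms by linarith
  then have S2: "S 2 \<le> 2 * s\<^sup>2 * S 0 + S 1 / 2" by (simp add: S)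
  show "S 1 \<le> 2 * s * S 0"
  proof (rule ccontr)
    assume "\<not> S 1 \<le> 2 * s * S 0"
    then have lt: "S 1 > 2 * s * S 0" by simp
    have "S 1 * S 1 \<le> (2 * s\<^sup>2 * S 0 + S 1 / 2) * S 0"
      using CS mult_right_mono[OF S2 less_imp_le[OF pos]] unfolding power2_eq_square
      by (rule order_trans)
    then have "S 1 * (S 1 - S 0 / 2) \<le> 2 * s\<^sup>2 * S 0 * S 0" by (simp add: algebra_simps)
    \<comment> \<open>If \<open>mu > 2 s\<close>, then \<open>mu - 1/2 > 3 s / 2\<close> because
      \<open>s >= 1\<close>, so the product exceeds \<open>3 s^2\<close>, against the upper bound
      \<open>2 s^2\<close>.\<close>
    moreover have "(2 * s * S 0) * (3 / 2 * s * S 0) < S 1 * (S 1 - S 0 / 2)"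
    proof (rule mult_strict_mono)
      have "S 0 \<le> s * S 0" using assms(1) pos by simp
      then show "3 / 2 * s * S 0 < S 1 - S 0 / 2" using lt by linarith
      have "0 \<le> 2 * s * S 0" using assms(1) pos by simp
      with lt show "0 < S 1" by linarith
    qed (use lt pos assms(1) in auto)
    ultimately have "3 * (s * S 0)\<^sup>2 < 2 * (s * S 0)\<^sup>2"
      by (simp add: power2_eq_square algebra_simps)
    then show False using zero_le_power2[of "s * S 0"] by linarith
  qed
qed

text \<open>Weighting by the decreasing function \<open>1 - |x| / M\<close> does not increase the mean of \<open>|x|\<close>:
  this is just \<open>E|x|\<^sup>2 \<ge> (E|x|)\<^sup>2\<close>.\<close>

lemma tilted_truncated_gaussian:
  fixes s t :: real
  assumes "s \<ge> 1" "t \<ge> 0"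
  defines "M \<equiv> 2 * real_of_int \<lfloor>t\<rfloor> + 1"
  shows "(\<integral>\<^sup>+x. ennreal \<bar>real_of_int x\<bar> * ennreal (1 - \<bar>real_of_int x\<bar> / M) \<partial>truncated_gaussian s t)
    \<le> ennreal (2 * s) * (\<integral>\<^sup>+x. ennreal (1 - \<bar>real_of_int x\<bar> / M) \<partial>truncated_gaussian s t)"
proof -
  define T where "T = nat \<lfloor>t\<rfloor>"
  have T: "\<lfloor>t\<rfloor> = int T" "M = 2 * real T + 1" using assms by (auto simp: T_def)
  define S where "S j = (\<Sum>x = - int T..int T. \<bar>real_of_int x\<bar> ^ j * gaussian_weight s x)" for j
  note mom = gaussian_first_moment[OF assms(1), of T, folded S_def]
  from assms have "s > 0" by simp
  then obtain c where c: "c > 0" and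
    int: "\<And>f. (\<integral>\<^sup>+x. ennreal (f x) \<partial>truncated_gaussian s t) =
      (\<Sum>x = - \<lfloor>t\<rfloor>..\<lfloor>t\<rfloor>. ennreal (f x) * ennreal (c * gaussian_weight s x))"
    using nn_integral_truncated_gaussian[OF _ assms(2)] by metis
  have g: "gaussian_weight s x \<ge> 0" for x by (simp add: gaussian_weight_def)
  \<comment> \<open>\<open>M\<close> counts the integers in \<open>{- T..T}\<close>, and
    \<open>1 - |x| / M\<close> is the fraction of them that a shift by \<open>x\<close> keeps
    inside.\<close>
  have w: "0 \<le> 1 - \<bar>real_of_int x\<bar> / M" if "x \<in> {- int T..int T}" for x
    using that by (auto simp: T field_simps)
  have eval: "(\<integral>\<^sup>+x. ennreal (\<bar>real_of_int x\<bar> ^ j * (1 - \<bar>real_of_int x\<bar> / M)) \<partial>truncated_gaussian s t)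
    = ennreal (c * (S j - S (Suc j) / M))" for j :: nat
  proof -
    have "(\<integral>\<^sup>+x. ennreal (\<bar>real_of_int x\<bar> ^ j * (1 - \<bar>real_of_int x\<bar> / M)) \<partial>truncated_gaussian s t)
      = (\<Sum>x = - int T..int T. ennreal (\<bar>real_of_int x\<bar> ^ j * (1 - \<bar>real_of_int x\<bar> / M) * (c * gaussian_weight s x)))"
      unfolding int T(1) using g c w by (intro sum.cong refl ennreal_mult[symmetric]) auto
    also have "\<dots> = ennreal (\<Sum>x = - int T..int T. \<bar>real_of_int x\<bar> ^ j * (1 - \<bar>real_of_int x\<bar> / M) * (c * gaussian_weight s x))"
      using g c w by (intro sum_ennreal) (auto intro!: mult_nonneg_nonneg)
    also have "(\<Sum>x = - int T..int T. \<bar>real_of_int x\<bar> ^ j * (1 - \<bar>real_of_int x\<bar> / M) * (c * gaussian_weight s x))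
      = c * (S j - S (Suc j) / M)"
      unfolding S_def sum_divide_distrib sum_subtractf[symmetric] sum_distrib_left
      by (intro sum.cong) (auto simp: algebra_simps)
    finally show ?thesis .
  qed
  have "S 1 - S 2 / M \<le> 2 * s * (S 0 - S 1 / M)"
  proof -
    have M: "M > 0" using T by simp
    have "S 1 * S 1 / S 0 \<le> S 2"
      using mom(2,3) by (simp only: pos_divide_le_eq power2_eq_square)
    then have "S 1 * S 1 / S 0 / M \<le> S 2 / M"
      using M by (intro divide_right_mono) auto
    \<comment> \<open>The tilted first moment is at most the untilted mean times the tilted mass.
      Replacing that mean by \<open>2 * s\<close> requires the mass to be nonnegative.\<close>
    then have "S 1 - S 2 / M \<le> S 1 / S 0 * (S 0 - S 1 / M)"
      by (simp add: right_diff_distrib less_imp_neq[OF mom(3), symmetric])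
    also have "\<dots> \<le> 2 * s * (S 0 - S 1 / M)"
    proof (rule mult_right_mono)
      show "S 1 / S 0 \<le> 2 * s" using mom by (simp add: field_simps)
      have "real T * S 0 \<le> M * S 0" using mom(3) T(2) by (intro mult_right_mono) auto
      with mom(4) have "S 1 \<le> M * S 0" by linarith
      then show "0 \<le> S 0 - S 1 / M" using M by (simp add: field_simps)
    qed
    finally show ?thesis .
  qed
  then have "c * (S 1 - S 2 / M) \<le> 2 * s * (c * (S 0 - S 1 / M))"
    using mult_left_mono[OF _ less_imp_le[OF c]] by (metis mult.left_commute)
  then have "ennreal (c * (S 1 - S 2 / M)) \<le> ennreal (2 * s) * ennreal (c * (S 0 - S 1 / M))"
    using \<open>s > 0\<close> by (subst ennreal_mult'[symmetric]) (auto intro: ennreal_leI)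
  then show ?thesis
    using eval[of 1] eval[of 0] by (simp add: ennreal_mult' numeral_2_eq_2)
qed

text \<open>A product weight keeps the coordinates independent, so each summand sees the tilt of its
  own coordinate and only the total weight of the others. Stated without quotients, the inequality
  survives a total weight of 0 or infinity.\<close>

lemma nn_integral_tilted_replicate_pmf:
  fixes h w :: "'a \<Rightarrow> ennreal" and p :: "'a pmf"
  assumes "(\<integral>\<^sup>+x. h x * w x \<partial>p) \<le> c * (\<integral>\<^sup>+x. w x \<partial>p)"
  shows "(\<integral>\<^sup>+xs. (\<Sum>x\<leftarrow>xs. h x) * (\<Prod>x\<leftarrow>xs. w x) \<partial>replicate_pmf k p)
    \<le> of_nat k * c * (\<integral>\<^sup>+xs. (\<Prod>x\<leftarrow>xs. w x) \<partial>replicate_pmf k p)"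
proof (induction k)
  case (Suc k)
  let ?W1 = "\<integral>\<^sup>+x. w x \<partial>p" and ?W = "\<integral>\<^sup>+xs. (\<Prod>x\<leftarrow>xs. w x) \<partial>replicate_pmf k p"
  let ?F = "\<integral>\<^sup>+xs. (\<Sum>x\<leftarrow>xs. h x) * (\<Prod>x\<leftarrow>xs. w x) \<partial>replicate_pmf k p"
  have "(\<integral>\<^sup>+xs. (\<Sum>x\<leftarrow>xs. h x) * (\<Prod>x\<leftarrow>xs. w x) \<partial>replicate_pmf (Suc k) p)
    = (\<integral>\<^sup>+x. \<integral>\<^sup>+xs. h x * w x * (\<Prod>x\<leftarrow>xs. w x) + w x * ((\<Sum>x\<leftarrow>xs. h x) * (\<Prod>x\<leftarrow>xs. w x))
        \<partial>replicate_pmf k p \<partial>p)"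
    by (simp add: algebra_simps)
  also have "\<dots> = (\<integral>\<^sup>+x. h x * w x * ?W + w x * ?F \<partial>p)"
    by (simp add: nn_integral_add nn_integral_cmult)
  also have "\<dots> = (\<integral>\<^sup>+x. h x * w x \<partial>p) * ?W + ?W1 * ?F"
    by (simp add: nn_integral_add nn_integral_multc)
  also have "\<dots> \<le> c * ?W1 * ?W + ?W1 * (of_nat k * c * ?W)"
    by (intro add_mono mult_mono assms Suc.IH) auto
  also have "\<dots> = of_nat (Suc k) * c * (?W1 * ?W)"
    by (simp add: algebra_simps)
  also have "?W1 * ?W = (\<integral>\<^sup>+xs. (\<Prod>x\<leftarrow>xs. w x) \<partial>replicate_pmf (Suc k) p)"
    by (simp add: nn_integral_cmult nn_integral_multc)
  finally show ?case .
qed simp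

subsection \<open>Short vectors and binary expansions\<close>

text \<open>Constraints on separate coordinates describe a product set, so counting short vectors
  reduces to counting residues.\<close>

lemma vec_box:
  assumes "\<And>i. i < d \<Longrightarrow> finite (B i)"
  shows "finite {v \<in> carrier_vec d. \<forall>i<d. v $ i \<in> B i}" (is "finite ?V")
    and "card {v \<in> carrier_vec d. \<forall>i<d. v $ i \<in> B i} = (\<Prod>i<d. card (B i))"
proof -
  have bij: "bij_betw (\<lambda>f. vec d f) (Pi\<^sub>E {..<d} B) ?V"
    by (rule bij_betwI[where g = "\<lambda>v. restrict (\<lambda>i. v $ i) {..<d}"])
       (auto simp: PiE_def extensional_def fun_eq_iff Pi_def restrict_def intro!: eq_vecI)
  have "finite (Pi\<^sub>E {..<d} B)" using assms by (intro finite_PiE) auto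
  then show "finite ?V" using bij bij_betw_finite by blast
  show "card ?V = (\<Prod>i<d. card (B i))"
    using bij_betw_same_card[OF bij] by (simp add: card_PiE)
qed

lemma finite_Zvec: "finite (Zvec q d)"
  using vec_box(1)[of d "\<lambda>_. {0..<int q}"] by (simp add: Zvec_def)

lemma Zvec_nonempty: "q > 0 \<Longrightarrow> Zvec q d \<noteq> {}"
  by (auto simp: Zvec_def intro!: exI[of _ "0\<^sub>v d"])

lemma index_vmod [simp]: "i < dim_vec v \<Longrightarrow> (v vmod q) $ i = v $ i mod int q"
  and dim_vmod [simp]: "dim_vec (v vmod q) = dim_vec v"
  by (simp_all add: vmod_def)

lemma vmod_in_Zvec: "q > 0 \<Longrightarrow> v \<in> carrier_vec d \<Longrightarrow> v vmod q \<in> Zvec q d"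
  by (auto simp: Zvec_def vmod_def)

lemma vmod_eqI:
  assumes "dim_vec u = dim_vec v" "\<And>i. i < dim_vec v \<Longrightarrow> [u $ i = v $ i] (mod int q)"
  shows "u vmod q = v vmod q"
  using assms by (intro eq_vecI) (auto simp: cong_def)

lemma vmod_eqD:
  assumes "u vmod q = v vmod q" "i < dim_vec v"
  shows "[u $ i = v $ i] (mod int q)"
  using assms by (metis cong_def dim_vmod index_vmod)

lemma Zvec_dim: "v \<in> Zvec q d \<Longrightarrow> dim_vec v = d"
  and Zvec_index: "v \<in> Zvec q d \<Longrightarrow> i < d \<Longrightarrow> v $ i \<in> {0..<int q}"
  by (auto simp: Zvec_def)

lemma Zvec_eqI:
  assumes "u \<in> Zvec q d" "v \<in> Zvec q d" "\<And>i. i < d \<Longrightarrow> [u $ i = v $ i] (mod int q)"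
  shows "u = v"
  using assms by (intro eq_vecI) (auto simp: Zvec_def cong_def)

lemma scalar_prod_cong:
  fixes u v :: "int vec"
  assumes "dim_vec u = dim_vec v" "\<And>i. i < dim_vec v \<Longrightarrow> [u $ i = v $ i] (mod k)"
  shows "[w \<bullet> u = w \<bullet> v] (mod k)"
  unfolding scalar_prod_def assms(1) using assms(2)
  by (intro cong_sum cong_mult) auto

text \<open>The balanced representative, in \<open>(-q/2, q/2]\<close> for residues in
  \<open>{0..<q}\<close>. It turns \<open>zabs\<close> into an ordinary absolute value, for which
  the triangle inequality is available.\<close>

definition centered :: "nat \<Rightarrow> int \<Rightarrow> int" where
  "centered q x = (if 2 * x \<le> int q then x else x - int q)"

lemma centered_cong: "[centered q x = x] (mod int q)"
  by (simp add: centered_def cong_iff_dvd_diff)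

lemma abs_centered: "x \<in> {0..<int q} \<Longrightarrow> \<bar>centered q x\<bar> = zabs q x"
  by (auto simp: centered_def zabs_def)

lemma zabs_mod:
  assumes "2 * \<bar>c\<bar> \<le> int q" "q > 0"
  shows "zabs q (c mod int q) = \<bar>c\<bar>"
proof (cases "c \<ge> 0")
  case True
  then have "c mod int q = c" using assms by (intro mod_pos_pos_trivial) auto
  then show ?thesis using True assms by (auto simp: zabs_def)
next
  case False
  then have "c mod int q = c + int q"
    using assms mod_pos_pos_trivial[of "c + int q" "int q"] by auto
  then show ?thesis using False assms by (auto simp: zabs_def)
qed

text \<open>The norm is an integer, so the real bound may be replaced by its floor;
  \<open>d > 0\<close> keeps \<open>Max\<close> off the empty set.\<close>

lemma short_vecs_eq:
  assumes "d > 0"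
  shows "short_vecs q d t =
    {g \<in> carrier_vec d. \<forall>i<d. g $ i \<in> {0..<int q} \<and> zabs q (g $ i) \<le> \<lfloor>t\<rfloor>}"
proof -
  have "real_of_int (zinf_norm q g) \<le> t \<longleftrightarrow> (\<forall>i<d. zabs q (g $ i) \<le> \<lfloor>t\<rfloor>)"
    if "g \<in> carrier_vec d" for g
  proof -
    have "real_of_int (zinf_norm q g) \<le> t \<longleftrightarrow> zinf_norm q g \<le> \<lfloor>t\<rfloor>"
      by (simp add: le_floor_iff)
    then show ?thesis
      using that assms unfolding zinf_norm_def by (subst (asm) Max_le_iff) auto
  qed
  then show ?thesis by (auto simp: short_vecs_def Zvec_def)
qed

text \<open>In the centered representation the two conditions cut out an interval.\<close>

lemma card_short_shift:
  assumes "e \<in> {0..<int q}" "zabs q e \<le> T" "4 * T < int q"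
  shows "card {g \<in> {0..<int q}. zabs q g \<le> T \<and> zabs q ((g + e) mod int q) \<le> T}
    = nat (2 * T + 1 - zabs q e)"
proof -
  define e' where "e' = centered q e"
  have e': "\<bar>e'\<bar> = zabs q e" "[e' = e] (mod int q)"
    using assms abs_centered centered_cong by (auto simp: e'_def)
  have q: "q > 0" using assms by auto
  let ?I = "{max (- T) (- T - e')..min T (T - e')}"
  \<comment> \<open>The sum of two representatives bounded by \<open>T\<close> stays within
    \<open>2 T\<close>, and \<open>4 * T < int q\<close> puts this below \<open>q / 2\<close>: no
    wraparound.\<close>
  have zc: "zabs q (c mod int q) = \<bar>c\<bar>" "zabs q ((c + e') mod int q) = \<bar>c + e'\<bar>"
    if "\<bar>c\<bar> \<le> T" for c
  proof -
    have "\<bar>c + e'\<bar> \<le> T + T"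
      using that e'(1) assms(2) by (intro order_trans[OF abs_triangle_ineq] add_mono) auto
    then show "zabs q (c mod int q) = \<bar>c\<bar>" "zabs q ((c + e') mod int q) = \<bar>c + e'\<bar>"
      using that assms(3) q by (auto intro!: zabs_mod)
  qed
  have shift: "zabs q ((g + e) mod int q) = zabs q ((c + e') mod int q)" if "[c = g] (mod int q)" for c g
    using that e'(2) by (metis cong_add cong_def)
  have "{g \<in> {0..<int q}. zabs q g \<le> T \<and> zabs q ((g + e) mod int q) \<le> T} = (\<lambda>c. c mod int q) ` ?I"
  proof (intro equalityI subsetI)
    fix g assume g: "g \<in> {g \<in> {0..<int q}. zabs q g \<le> T \<and> zabs q ((g + e) mod int q) \<le> T}"
    then have c: "\<bar>centered q g\<bar> \<le> T" using abs_centered by simp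
    moreover have "\<bar>centered q g + e'\<bar> \<le> T"
      using g zc[OF c] shift[OF centered_cong] by simp
    moreover have "g = centered q g mod int q" using g centered_cong[of q g] by (auto simp: cong_def)
    ultimately show "g \<in> (\<lambda>c. c mod int q) ` ?I" by (intro image_eqI) auto
  next
    fix g assume "g \<in> (\<lambda>c. c mod int q) ` ?I"
    then obtain c where c: "g = c mod int q" "\<bar>c\<bar> \<le> T" "\<bar>c + e'\<bar> \<le> T" by auto
    then have "[c = g] (mod int q)" by simp
    then show "g \<in> {g \<in> {0..<int q}. zabs q g \<le> T \<and> zabs q ((g + e) mod int q) \<le> T}"
      using zc[OF c(2)] shift[of c g] c q by simp
  qed
  \<comment> \<open>Points of the interval differ by at most \<open>2 T < q\<close>.\<close>
  moreover have "inj_on (\<lambda>c. c mod int q) ?I"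
  proof (rule inj_onI)
    fix a b assume ab: "a \<in> ?I" "b \<in> ?I" "a mod int q = b mod int q"
    then have "int q dvd a - b" by (simp add: mod_eq_dvd_iff)
    moreover have "\<bar>a - b\<bar> < int q" using ab assms by auto
    ultimately show "a = b" using zdvd_not_zless by (metis abs_ge_zero abs_of_nonneg abs_zero dvd_abs_iff eq_iff_diff_eq_0 zero_less_abs_iff)
  qed
  ultimately have "card {g \<in> {0..<int q}. zabs q g \<le> T \<and> zabs q ((g + e) mod int q) \<le> T} = card ?I"
    by (simp add: card_image)
  \<comment> \<open>A shift cuts the interval at one end only, by \<open>|e'|\<close>
    points.\<close>
  also have "\<dots> = nat (2 * T + 1 - zabs q e)"
    using assms e' by (auto simp: min_def max_def)
  finally show ?thesis .
qed

lemma finite_short_vecs: "finite (short_vecs q d t)"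
  using finite_Zvec finite_subset unfolding short_vecs_def by (metis (no_types, lifting) mem_Collect_eq subsetI)

text \<open>The coordinates decouple, and each contributes the overlap of an interval with its shift
  by \<open>e $ i\<close>. This is the origin of the factors \<open>1 - |e_i| / M\<close>.\<close>

lemma card_short_vecs_shift:
  assumes "e \<in> short_vecs q d t" "4 * t < real q" "d > 0"
  shows "real (card {g \<in> short_vecs q d t. (g + e) vmod q \<in> short_vecs q d t})
    = (\<Prod>i<d. 2 * real_of_int \<lfloor>t\<rfloor> + 1 - real_of_int (zabs q (e $ i)))"
proof -
  let ?T = "\<lfloor>t\<rfloor>"
  have T: "4 * ?T < int q" using assms(2) by linarith
  have e: "e $ i \<in> {0..<int q}" "zabs q (e $ i) \<le> ?T" "dim_vec e = d" if "i < d" for i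
    using assms that by (auto simp: short_vecs_eq)
  have shift: "(g + e) vmod q \<in> {g \<in> carrier_vec d. \<forall>i<d. g $ i \<in> {0..<int q} \<and> zabs q (g $ i) \<le> ?T}
      \<longleftrightarrow> (\<forall>i<d. zabs q ((g $ i + e $ i) mod int q) \<le> ?T)" if "g \<in> carrier_vec d" for g
  proof -
    have "dim_vec e = d" using e(3)[OF assms(3)] .
    moreover have "int q > 0" using e(1)[OF assms(3)] by auto
    ultimately have "((g + e) vmod q) $ i = (g $ i + e $ i) mod int q"
      "(g $ i + e $ i) mod int q \<in> {0..<int q}" if "i < d" for i
      using that by simp_all
    moreover have "(g + e) vmod q \<in> carrier_vec d"
      using \<open>dim_vec e = d\<close> by (intro carrier_vecI) simp
    ultimately show ?thesis by auto
  qed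
  have "{g \<in> short_vecs q d t. (g + e) vmod q \<in> short_vecs q d t} =
    {g \<in> carrier_vec d. \<forall>i<d. g $ i \<in> {x \<in> {0..<int q}. zabs q x \<le> ?T \<and> zabs q ((x + e $ i) mod int q) \<le> ?T}}"
    unfolding short_vecs_eq[OF assms(3)] by (rule Collect_cong) (use shift in blast)
  then have "card {g \<in> short_vecs q d t. (g + e) vmod q \<in> short_vecs q d t} =
    (\<Prod>i<d. card {x \<in> {0..<int q}. zabs q x \<le> ?T \<and> zabs q ((x + e $ i) mod int q) \<le> ?T})"
    by (simp only:) (rule vec_box(2), rule finite_subset[of _ "{0..<int q}"], auto)
  also have "\<dots> = (\<Prod>i<d. nat (2 * ?T + 1 - zabs q (e $ i)))"
    using e T by (intro prod.cong refl card_short_shift) auto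
  finally show ?thesis
  proof -
    assume *: "card {g \<in> short_vecs q d t. (g + e) vmod q \<in> short_vecs q d t}
      = (\<Prod>i<d. nat (2 * ?T + 1 - zabs q (e $ i)))"
    have "real (nat (2 * ?T + 1 - zabs q (e $ i))) = 2 * real_of_int ?T + 1 - real_of_int (zabs q (e $ i))"
      if "i < d" for i
    proof -
      have "0 \<le> zabs q (e $ i)" using e(1)[OF that] by (auto simp: zabs_def)
      then show ?thesis using e(2)[OF that] by simp
    qed
    then show ?thesis unfolding * by simp
  qed
qed

lemma card_short_vecs:
  assumes "0 \<le> t" "4 * t < real q" "d > 0"
  shows "real (card (short_vecs q d t)) = (2 * real_of_int \<lfloor>t\<rfloor> + 1) ^ d"
proof -
  have q: "q > 0" using assms by (cases q) auto
  have "0\<^sub>v d \<in> short_vecs q d t" using assms q by (auto simp: short_vecs_eq zabs_def)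
  moreover have "(g + 0\<^sub>v d) vmod q = g" if "g \<in> short_vecs q d t" for g
    using that by (intro eq_vecI) (auto simp: short_vecs_def Zvec_def)
  then have "{g \<in> short_vecs q d t. (g + 0\<^sub>v d) vmod q \<in> short_vecs q d t} = short_vecs q d t"
    by auto
  ultimately show ?thesis
    using card_short_vecs_shift[of "0\<^sub>v d" q d t] assms by (simp add: zabs_def)
qed

section \<open>Binary expansions of residues and vectors\<close>

lemma bit_sum:
  assumes "k \<in> {0..<2 ^ Q}"
  shows "(\<Sum>j<Q. of_bool (bit k j) * 2 ^ j) = (k :: int)"
proof -
  have "take_bit Q k = k" using assms by (simp add: take_bit_int_eq_self_iff)
  then show ?thesis
    using horner_sum_bit_eq_take_bit[of k Q]
    by (simp add: horner_sum_eq_sum lessThan_atLeast0 atLeast_upt)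
qed

lemma concat_binary_nth:
  "k < length xs * Q \<Longrightarrow> concat (map (binary Q) xs) ! k = bit (xs ! (k div Q)) (k mod Q)"
proof (induction xs arbitrary: k)
  case (Cons x xs)
  have len: "length (binary Q x) = Q" by (simp add: binary_def)
  have Q: "Q > 0" using Cons.prems by (cases Q) auto
  show ?case
  proof (cases "k < Q")
    case True
    then show ?thesis by (simp add: nth_append len binary_def)
  next
    case False
    then have "k - Q < length xs * Q" using Cons.prems by auto
    then show ?thesis
      using False Q Cons.IH[of "k - Q"]
      by (simp add: nth_append len le_div_geq le_mod_geq)
  qed
qed simp

lemma binary_vec_nth:
  "k < dim_vec x * Q \<Longrightarrow> binary_vec Q x ! k = bit (x $ (k div Q)) (k mod Q)"
  unfolding binary_vec_def
  by (subst concat_binary_nth) (auto simp: less_mult_imp_div_less list_of_vec_index)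

lemma length_binary_vec: "length (binary_vec Q x) = dim_vec x * Q"
proof -
  have "length (concat (map (binary Q) xs)) = length xs * Q" for xs
    by (induction xs) (auto simp: binary_def)
  then show ?thesis by (simp add: binary_vec_def)
qed

text \<open>With \<open>q <= 2 ^ Q\<close> the stored bits determine each residue, so distinct
  vectors are orthogonal states of the first register.\<close>

lemma inj_on_binary_vec:
  assumes "q \<le> 2 ^ Q"
  shows "inj_on (binary_vec Q) (Zvec q d)"
proof (rule inj_onI)
  fix x y assume xy: "x \<in> Zvec q d" "y \<in> Zvec q d" and eq: "binary_vec Q x = binary_vec Q y"
  have "x $ i = y $ i" if i: "i < d" for i
  proof -
    have range: "x $ i \<in> {0..<2 ^ Q}" "y $ i \<in> {0..<2 ^ Q}"
      using Zvec_index[OF xy(1) i] Zvec_index[OF xy(2) i] assms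
      by (auto intro: less_le_trans simp: numeral_power_le_of_nat_cancel_iff)
    have "bit (x $ i) j = bit (y $ i) j" if j: "j < Q" for j
    proof -
      have "i * Q + j < d * Q"
        using i j mult_le_mono1[of "Suc i" d Q] by simp
      then show ?thesis
        using binary_vec_nth[of "i * Q + j" x Q] binary_vec_nth[of "i * Q + j" y Q] eq j
          Zvec_dim[OF xy(1)] Zvec_dim[OF xy(2)] by simp
    qed
    then have "(\<Sum>j<Q. of_bool (bit (x $ i) j) * 2 ^ j) = (\<Sum>j<Q. of_bool (bit (y $ i) j) * 2 ^ j :: int)"
      by (intro sum.cong) auto
    then show ?thesis by (simp only: bit_sum[OF range(1)] bit_sum[OF range(2)])
  qed
  then show "x = y" using xy by (intro eq_vecI) (auto simp: Zvec_def)
qed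

subsection \<open>Qubit measurements and trace norm\<close>

text \<open>Here \<open>M* M\<close> is \<open>|d|^2\<close> times the identity, so its
  characteristic polynomial has a single root of order 2, and both singular values are
  \<open>|d|\<close>.\<close>

lemma trace_norm_antidiagonal:
  assumes M: "M \<in> carrier_mat 2 2" "M $$ (0, 0) = 0" "M $$ (0, 1) = cnj d"
    "M $$ (1, 0) = d" "M $$ (1, 1) = 0"
  shows "trace_norm M = 2 * cmod d"
proof -
  define k :: complex where "k = complex_of_real ((cmod d)\<^sup>2)"
  have dd: "cnj d * d = k"
    unfolding k_def complex_norm_square by (simp add: mult.commute)
  have adj: "mat_adjoint M \<in> carrier_mat 2 2" "\<And>i j. i < 2 \<Longrightarrow> j < 2 \<Longrightarrow> mat_adjoint M $$ (i, j) = cnj (M $$ (j, i))"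
    using M(1) by (auto simp: mat_adjoint_def mat_of_rows_def)
  let ?B = "mat_adjoint M * M"
  have B: "?B \<in> carrier_mat 2 2" using M adj by auto
  have entries: "?B $$ (0, 0) = k" "?B $$ (0, Suc 0) = 0" "?B $$ (Suc 0, 0) = 0" "?B $$ (Suc 0, Suc 0) = k"
    using M adj dd by (auto simp: scalar_prod_def numeral_2_eq_2 mult.commute)
  have "char_poly ?B = (\<Prod>a\<leftarrow>diag_mat ?B. [:- a, 1:])"
    using entries adj(1) by (intro char_poly_upper_triangular[OF B])
      (auto simp: upper_triangular_def less_2_cases_iff numeral_2_eq_2 less_Suc_eq)
  also have "diag_mat ?B = [k, k]"
    using B entries unfolding diag_mat_def by (auto simp: numeral_2_eq_2 upt_rec)
  finally have p: "char_poly ?B = [:- k, 1:] ^ 2" by (simp add: power2_eq_square)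
  have "{\<mu>. poly (char_poly ?B) \<mu> = 0} = {k}" unfolding p by (auto simp: poly_power)
  moreover have "Polynomial.order k (char_poly ?B) = 2" unfolding p by (rule order_power_n_n)
  ultimately show ?thesis by (simp add: trace_norm_def k_def)
qed

text \<open>An equatorial qubit state with a global phase \<open>\<kappa>\<close>, carried along
  because \<open>eigenket\<close> is determined only up to a phase.\<close>

definition phase_ket :: "complex \<Rightarrow> complex \<Rightarrow> complex vec" where
  "phase_ket \<kappa> \<rho> = vec 2 (\<lambda>i. \<kappa> * (if i = 0 then 1 else \<rho>) / complex_of_real (sqrt 2))"

text \<open>Global phases cancel in the projectors and all diagonal entries are \<open>1/2\<close>,
  so the difference is antidiagonal.\<close>

lemma trace_norm_phase_kets:
  assumes "cmod \<kappa> = 1" "cmod \<kappa>' = 1" "cmod \<rho> = 1" "cmod \<rho>' = 1"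
  shows "trace_norm (ketbra (phase_ket \<kappa> \<rho>) - ketbra (phase_ket \<kappa>' \<rho>')) = cmod (\<rho> - \<rho>')"
proof -
  have s2: "complex_of_real (sqrt 2) * complex_of_real (sqrt 2) = 2"
    by (simp flip: of_real_mult)
  have cc: "\<kappa> * cnj \<kappa> = 1" "\<kappa>' * cnj \<kappa>' = 1" "\<rho> * cnj \<rho> = 1" "\<rho>' * cnj \<rho>' = 1"
    using assms by (simp_all flip: complex_norm_square)
  have entry: "ketbra (phase_ket \<kappa> \<rho>) $$ (i, j) =
      (if i = 0 then 1 else \<rho>) * (if j = 0 then 1 else cnj \<rho>) / 2"
    if "i < 2" "j < 2" "\<kappa> * cnj \<kappa> = 1" for \<kappa> \<rho> i j
  proof -
    have "ketbra (phase_ket \<kappa> \<rho>) $$ (i, j) =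
      (\<kappa> * cnj \<kappa>) * ((if i = 0 then 1 else \<rho>) * (if j = 0 then 1 else cnj \<rho>))
      / (complex_of_real (sqrt 2) * complex_of_real (sqrt 2))"
      using that(1,2) by (auto simp: ketbra_def phase_ket_def)
    then show ?thesis unfolding s2 that(3) by simp
  qed
  have carr: "ketbra (phase_ket \<kappa> \<rho>) \<in> carrier_mat 2 2" for \<kappa> \<rho>
    by (simp add: ketbra_def phase_ket_def)
  have "trace_norm (ketbra (phase_ket \<kappa> \<rho>) - ketbra (phase_ket \<kappa>' \<rho>')) = 2 * cmod ((\<rho> - \<rho>') / 2)"
    using carr[of \<kappa> \<rho>] carr[of \<kappa>' \<rho>']
    by (intro trace_norm_antidiagonal) (auto simp: entry cc diff_divide_distrib)
  then show ?thesis by (simp add: norm_divide)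
qed

text \<open>A chord is no longer than its arc.\<close>

lemma norm_cis_diff_le: "cmod (cis a - cis b) \<le> \<bar>a - b\<bar>"
proof -
  have "cis a - cis b = cis b * (exp (\<i> * complex_of_real (a - b)) - 1)"
    unfolding cis_conv_exp[symmetric] by (simp add: right_diff_distrib cis_mult)
  then have "cmod (cis a - cis b) = 2 * \<bar>sin ((a - b) / 2)\<bar>"
    by (simp only: norm_mult norm_cis dist_exp_i_1)
  also have "\<dots> \<le> 2 * \<bar>(a - b) / 2\<bar>"
    using abs_sin_x_le_abs_x[of "(a - b) / 2"] by (simp add: abs_mult)
  finally show ?thesis by simp
qed

text \<open>One row of the eigenvalue equation fixes the second entry from the first, and
  normalization fixes the modulus of the first. Its phase depends on the choice made in
  \<open>eigenket\<close>, so \<open>\<kappa>\<close> stays unspecified.\<close>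

lemma eigenket_xy_observable_entries:
  obtains \<kappa> where "cmod \<kappa> = 1 / sqrt 2"
    and "\<And>b. eigenket (xy_observable r) ((- 1) ^ of_bool u) $ of_bool b
          = \<kappa> * (if b then (- 1) ^ of_bool u * cis r else 1)"
proof -
  define M \<mu> v where "M = xy_observable r" and "\<mu> = ((- 1) ^ of_bool u :: complex)"
    and "v = eigenket M \<mu>"
  have M: "M \<in> carrier_mat 2 2"
    "M $$ (0, 0) = 0" "M $$ (0, Suc 0) = cnj (cis r)"
    "M $$ (Suc 0, 0) = cis r" "M $$ (Suc 0, Suc 0) = 0"
    by (auto simp: M_def xy_observable_def pauli_X_def pauli_Y_def mat_of_rows_list_def
        complex_eq_iff)
  have ev: "eigenvector M v \<mu>" and norm: "v \<bullet>c v = 1"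
    using eigenket_xy_observable[of r u] by (auto simp: M_def \<mu>_def v_def)
  have dim: "dim_vec v = 2" using ev M by (auto simp: eigenvector_def)
  have "(M *\<^sub>v v) $ 1 = \<mu> * v $ 1"
    using ev dim M(1) unfolding eigenvector_def by (metis index_smult_vec(1) one_less_numeral_iff semiring_norm(76))
  then have "cis r * v $ 0 = \<mu> * v $ 1"
    using M dim by (simp add: scalar_prod_def numeral_2_eq_2)
  moreover have "\<mu> * \<mu> = 1" by (simp add: \<mu>_def)
  ultimately have v1: "v $ 1 = v $ 0 * (\<mu> * cis r)"
    by (metis (no_types, opaque_lifting) mult.assoc mult.commute mult_1)
  have "cmod (v $ 1) = cmod (v $ 0)" unfolding v1 by (simp add: norm_mult norm_power \<mu>_def)
  moreover have "complex_of_real ((cmod (v $ 0))\<^sup>2 + (cmod (v $ 1))\<^sup>2) = 1"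
    using norm dim unfolding of_real_add complex_norm_square by (simp add: scalar_prod_def numeral_2_eq_2)
  then have "(cmod (v $ 0))\<^sup>2 + (cmod (v $ 1))\<^sup>2 = 1"
    using of_real_eq_1_iff by blast
  ultimately have "(cmod (v $ 0))\<^sup>2 = 1 / 2" by simp
  then have "cmod (v $ 0) = 1 / sqrt 2"
    by (metis norm_ge_zero real_sqrt_divide real_sqrt_one real_sqrt_unique)
  then show thesis
    by (rule that) (use v1 in \<open>auto simp: v_def M_def \<mu>_def\<close>)
qed

text \<open>The phase that \<open>bs\<close> acquires on projection onto the outcome
  \<open>u\<close>, without the factors independent of \<open>bs\<close>. The bra conjugates
  \<open>cis r\<close>, hence the sign of the angle.\<close>

definition bit_phase :: "nat \<Rightarrow> (nat \<Rightarrow> real) \<Rightarrow> bool list \<Rightarrow> bool list \<Rightarrow> complex" where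
  "bit_phase N r u bs = (\<Prod>k<N. if bs ! k then (- 1) ^ of_bool (u ! k) * cis (- r k) else 1)"

lemma bit_phase_eq:
  "bit_phase N r u bs = (- 1) ^ (\<Sum>k<N. of_bool (bs ! k) * of_bool (u ! k))
     * cis (- (\<Sum>k<N. of_bool (bs ! k) * r k))"
  unfolding bit_phase_def
  by (induction N) (auto simp: cis_mult power_add algebra_simps)

lemma norm_bit_phase: "cmod (bit_phase N r u bs) = 1"
  by (simp add: bit_phase_eq norm_mult norm_power)

lemma finite_bitstrings: "finite (bitstrings N)"
  and card_bitstrings: "card (bitstrings N) = 2 ^ N"
  using finite_lists_length_eq[of "UNIV :: bool set" N] card_lists_length_eq[of "UNIV :: bool set" N]
  by (auto simp: bitstrings_def)

text \<open>For each \<open>c\<close> a single string has nonzero amplitude, so one term of the sum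
  remains. The factor \<open>K\<close> is independent of \<open>c\<close>, hence a global phase
  after normalization, and its modulus is independent of \<open>u\<close>, hence all outcomes are
  equally likely.\<close>

lemma measure_qubits_residual_cat:
  assumes \<psi>: "\<psi> = (\<lambda>(bs, c). of_bool (bs = X c) * \<gamma>)" and X: "\<And>c. X c \<in> bitstrings N"
  obtains K where "cmod K = 1 / sqrt 2 ^ N" and
    "\<And>c. measure_qubits_residual N r \<psi> u c = K * \<gamma> * bit_phase N r u (X c)"
proof -
  let ?\<eta> = "\<lambda>k. eigenket (xy_observable (r k)) ((- 1) ^ of_bool (u ! k))"
  have "\<exists>\<kappa>. cmod \<kappa> = 1 / sqrt 2 \<and> (\<forall>b. ?\<eta> k $ of_bool b
          = \<kappa> * (if b then (- 1) ^ of_bool (u ! k) * cis (r k) else 1))" for k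
    using eigenket_xy_observable_entries[of "r k" "u ! k"] by metis
  then obtain \<kappa> where \<kappa>: "\<And>k. cmod (\<kappa> k) = 1 / sqrt 2"
    "\<And>k b. ?\<eta> k $ of_bool b = \<kappa> k * (if b then (- 1) ^ of_bool (u ! k) * cis (r k) else 1)"
    by metis
  show thesis
  proof
    show "cmod (\<Prod>k<N. cnj (\<kappa> k)) = 1 / sqrt 2 ^ N"
      by (simp add: \<kappa> power_one_over flip: prod_norm)
    fix c
    have "measure_qubits_residual N r \<psi> u c =
      (\<Sum>bs\<in>bitstrings N. if bs = X c then (\<Prod>k<N. cnj (?\<eta> k $ of_bool (bs ! k))) * \<gamma> else 0)"
      unfolding measure_qubits_residual_def \<psi> by (intro sum.cong) auto
    also have "\<dots> = (\<Prod>k<N. cnj (?\<eta> k $ of_bool (X c ! k))) * \<gamma>"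
      using X by (simp add: finite_bitstrings)
    also have "(\<Prod>k<N. cnj (?\<eta> k $ of_bool (X c ! k))) = (\<Prod>k<N. cnj (\<kappa> k)) * bit_phase N r u (X c)"
      unfolding \<kappa> bit_phase_def prod.distrib[symmetric] by (intro prod.cong) (auto simp: cis_cnj)
    finally show "measure_qubits_residual N r \<psi> u c = (\<Prod>k<N. cnj (\<kappa> k)) * \<gamma> * bit_phase N r u (X c)"
      by (simp add: ac_simps)
  qed
qed

lemma sq_norm_bool: "sq_norm UNIV \<psi> = (cmod (\<psi> False))\<^sup>2 + (cmod (\<psi> True))\<^sup>2"
  by (simp add: sq_norm_def UNIV_bool)

lemma sq_norm_nonneg: "sq_norm B \<psi> \<ge> 0"
  by (simp add: sq_norm_def sum_nonneg)

text \<open>Born weights of total 1 are what \<open>embed_pmf\<close> requires; measurements are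
  used below only through this \<open>p\<close>.\<close>

lemma measurement_eq:
  assumes "finite O'" "(\<Sum>o'\<in>O'. sq_norm B (R o')) = 1"
  obtains p where "measurement B O' R =
      map_pmf (\<lambda>o'. (o', \<lambda>b. R o' b / complex_of_real (sqrt (sq_norm B (R o'))))) p"
    and "\<And>o'. pmf p o' = (if o' \<in> O' then sq_norm B (R o') else 0)"
    and "set_pmf p \<subseteq> O'"
proof -
  define p where "p = embed_pmf (\<lambda>o'. if o' \<in> O' then sq_norm B (R o') else 0)"
  have "(\<integral>\<^sup>+o'. ennreal (if o' \<in> O' then sq_norm B (R o') else 0) \<partial>count_space UNIV)
    = (\<Sum>o'\<in>O'. ennreal (sq_norm B (R o')))"
    using assms(1) by (subst nn_integral_count_space'[of O']) auto
  also have "\<dots> = 1" using assms(2) by (simp add: sum_ennreal sq_norm_nonneg)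
  finally have pmf: "pmf p o' = (if o' \<in> O' then sq_norm B (R o') else 0)" for o'
    unfolding p_def by (intro pmf_embed_pmf) (auto simp: sq_norm_nonneg)
  show thesis
    by (rule that[of p]) (auto simp: measurement_def p_def[symmetric] pmf set_pmf_eq)
qed

subsection \<open>Unique decoding\<close>

text \<open>One output \<open>(A, t)\<close> of the trapdoor generator, with \<open>recover\<close>
  for inversion by \<open>t\<close>. The bound \<open>4 * \<tau> < real q\<close> excludes
  wraparound in sums and differences of two short vectors.\<close>

locale lwe_matrix =
  fixes q Q n m :: nat and \<tau> :: real and A :: "int mat" and recover :: "int vec \<Rightarrow> int vec"
  assumes q_pos: "q > 0" and q_le: "q \<le> 2 ^ Q" and m_pos: "m > 0"
    and tau_nonneg: "0 \<le> \<tau>" and tau_less: "4 * \<tau> < real q"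
    and A: "A \<in> Zmat q m n"
    and recover: "\<And>s e. s \<in> Zvec q n \<Longrightarrow> e \<in> short_vecs q m (2 * \<tau>) \<Longrightarrow> recover ((A *\<^sub>v s + e) vmod q) = s"
begin

abbreviation "short \<equiv> short_vecs q m \<tau>"

lemma A_carrier: "A \<in> carrier_mat m n" using A by (simp add: Zmat_def)

lemma A_dims [simp]: "dim_row A = m" "dim_col A = n" using A_carrier by auto

lemma short_Zvec: "g \<in> short \<Longrightarrow> g \<in> Zvec q m" by (simp add: short_vecs_def)

lemma recover': "s \<in> Zvec q n \<Longrightarrow> e \<in> short \<Longrightarrow> recover ((A *\<^sub>v s + e) vmod q) = s"
  using tau_nonneg by (intro recover) (auto simp: short_vecs_def)

lemma shift_mult:
  assumes "x \<in> Zvec q n" "s \<in> Zvec q n" "i < m"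
  shows "[(A *\<^sub>v ((x + s) vmod q)) $ i = (A *\<^sub>v x) $ i + (A *\<^sub>v s) $ i] (mod int q)"
proof -
  have d: "dim_vec x = n" "dim_vec s = n" using assms Zvec_dim by auto
  have "[row A i \<bullet> ((x + s) vmod q) = row A i \<bullet> (x + s)] (mod int q)"
    using d by (intro scalar_prod_cong) (auto simp: cong_def)
  also have "row A i \<bullet> (x + s) = row A i \<bullet> x + row A i \<bullet> s"
    using d row_carrier[of A i] A_carrier by (intro scalar_prod_add_distrib[of _ n] carrier_vecI) auto
  finally show ?thesis using assms(3) by simp
qed

text \<open>The pair \<open>(x, g)\<close> stands for the outcome \<open>A x + g\<close>.\<close>

definition accepted :: "int vec \<Rightarrow> (int vec \<times> int vec) set" where
  "accepted e = Zvec q n \<times> {g \<in> short. (g + e) vmod q \<in> short}"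

text \<open>Mod q, \<open>A x' - v + g'\<close> is \<open>A (x' - s) + (g' - e)\<close>, and
  \<open>g' - e\<close> is still within the inversion radius. Decoding therefore forces
  \<open>x' - s = x\<close>, and cancelling \<open>A x\<close> determines the noise.\<close>

lemma lift_eq_iff:
  assumes "x \<in> Zvec q n" "s \<in> Zvec q n" "e \<in> short" "g \<in> short" "g' \<in> short" "x' \<in> Zvec q n"
  defines "v \<equiv> (A *\<^sub>v s + e) vmod q"
  shows "(A *\<^sub>v x' - v + g') vmod q = (A *\<^sub>v x + g) vmod q \<longleftrightarrow>
    x' = (x + s) vmod q \<and> g' = (g + e) vmod q"
proof
  have d: "dim_vec x = n" "dim_vec s = n" "dim_vec x' = n" "dim_vec e = m" "dim_vec g = m" "dim_vec g' = m"
    using assms Zvec_dim short_Zvec by blast+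
  have dv: "dim_vec v = m" by (simp add: v_def d)
  have v: "[v $ i = (A *\<^sub>v s) $ i + e $ i] (mod int q)" if "i < m" for i
    using that d by (simp add: v_def cong_def)
  {
    assume eq: "(A *\<^sub>v x' - v + g') vmod q = (A *\<^sub>v x + g) vmod q"
    define z where "z = (x' - s) vmod q"
    have z: "z \<in> Zvec q n" using d q_pos by (auto simp: z_def intro!: vmod_in_Zvec carrier_vecI)
    have "(z + s) vmod q = x'"
      using d assms(6) z by (intro Zvec_eqI[of _ q n] vmod_in_Zvec q_pos)
        (auto simp: z_def cong_def mod_simps Zvec_dim intro!: carrier_vecI)
    with shift_mult[OF z assms(2)]
    have zs: "[(A *\<^sub>v x') $ i = (A *\<^sub>v z) $ i + (A *\<^sub>v s) $ i] (mod int q)" if "i < m" for i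
      using that by simp
    define h where "h = (g' - e) vmod q"
    have "h \<in> short_vecs q m (2 * \<tau>)"
    proof -
      have "zabs q ((g' $ i - e $ i) mod int q) \<le> \<lfloor>2 * \<tau>\<rfloor>" if i: "i < m" for i
      proof -
        let ?c = "centered q (g' $ i) - centered q (e $ i)"
        have b: "\<bar>centered q (g' $ i)\<bar> \<le> \<lfloor>\<tau>\<rfloor>" "\<bar>centered q (e $ i)\<bar> \<le> \<lfloor>\<tau>\<rfloor>"
          using assms(3,5) i by (auto simp: short_vecs_eq[OF m_pos] abs_centered)
        then have c: "\<bar>?c\<bar> \<le> \<lfloor>2 * \<tau>\<rfloor>" by linarith
        moreover have "2 * \<bar>?c\<bar> \<le> int q"
        proof -
          have "2 * \<bar>?c\<bar> \<le> 2 * \<lfloor>2 * \<tau>\<rfloor>" using c by (rule mult_left_mono) simp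
          also have "\<dots> \<le> int q" using tau_less by linarith
          finally show ?thesis .
        qed
        moreover have "(g' $ i - e $ i) mod int q = ?c mod int q"
          using centered_cong cong_diff unfolding cong_def[symmetric] by (metis cong_sym)
        ultimately show ?thesis using zabs_mod[of ?c q] q_pos by simp
      qed
      then show ?thesis
        using d q_pos by (auto simp: short_vecs_eq[OF m_pos] h_def intro!: carrier_vecI)
    qed
    moreover have zh: "(A *\<^sub>v z + h) vmod q = (A *\<^sub>v x + g) vmod q"
      unfolding eq[symmetric]
    proof (rule vmod_eqI)
      fix i assume "i < dim_vec (A *\<^sub>v x' - v + g')"
      then have i: "i < m" using d by simp
      have "[(A *\<^sub>v z) $ i + (g' $ i - e $ i) =
         (A *\<^sub>v z) $ i + (A *\<^sub>v s) $ i - ((A *\<^sub>v s) $ i + e $ i) + g' $ i] (mod int q)"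
        by (simp add: algebra_simps)
      also have "[(A *\<^sub>v z) $ i + (A *\<^sub>v s) $ i - ((A *\<^sub>v s) $ i + e $ i) + g' $ i =
          (A *\<^sub>v x') $ i - v $ i + g' $ i] (mod int q)"
        by (intro cong_add cong_diff cong_refl cong_sym[OF zs[OF i]] cong_sym[OF v[OF i]])
      finally have "[(A *\<^sub>v z) $ i + (g' $ i - e $ i) = (A *\<^sub>v x') $ i - v $ i + g' $ i] (mod int q)" .
      moreover have "[(A *\<^sub>v z) $ i + h $ i = (A *\<^sub>v z) $ i + (g' $ i - e $ i)] (mod int q)"
        using i d by (intro cong_add cong_refl) (simp add: h_def cong_def)
      ultimately have "[(A *\<^sub>v z) $ i + h $ i = (A *\<^sub>v x') $ i - v $ i + g' $ i] (mod int q)"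
        by (rule cong_trans[rotated])
      moreover have "dim_vec h = m" using d by (simp add: h_def)
      ultimately show "[(A *\<^sub>v z + h) $ i = (A *\<^sub>v x' - v + g') $ i] (mod int q)"
        using i d dv by simp
    qed (use d in \<open>simp add: h_def\<close>)
    \<comment> \<open>The same vector is decoded twice: as \<open>A z + h\<close> with noise up to
      \<open>2 * \<tau>\<close>, and as \<open>A x + g\<close> with noise up to
      \<open>\<tau>\<close>.\<close>
    ultimately have zx: "z = x" using recover[OF z] recover'[OF assms(1,4)] by metis
    have "g' = (g + e) vmod q"
    proof (rule Zvec_eqI[OF short_Zvec[OF assms(5)] vmod_in_Zvec[OF q_pos]])
      show "g + e \<in> carrier_vec m" using d by (intro carrier_vecI) simp
      fix i assume i: "i < m"
      have "[(A *\<^sub>v x) $ i + h $ i = (A *\<^sub>v x) $ i + g $ i] (mod int q)"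
        using vmod_eqD[OF zh, of i] i d by (simp add: zx h_def)
      then have "[h $ i = g $ i] (mod int q)" by (simp add: cong_add_lcancel)
      moreover have "[h $ i = g' $ i - e $ i] (mod int q)" using i d by (simp add: h_def cong_def)
      ultimately have "[g' $ i - e $ i + e $ i = g $ i + e $ i] (mod int q)"
        by (intro cong_add cong_refl) (metis cong_sym cong_trans)
      then show "[g' $ i = ((g + e) vmod q) $ i] (mod int q)" using i d by (simp add: cong_def)
    qed
    with zx \<open>(z + s) vmod q = x'\<close> show "x' = (x + s) vmod q \<and> g' = (g + e) vmod q" by simp
  }
  assume xg: "x' = (x + s) vmod q \<and> g' = (g + e) vmod q"
  show "(A *\<^sub>v x' - v + g') vmod q = (A *\<^sub>v x + g) vmod q"
  proof (rule vmod_eqI)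
    fix i assume "i < dim_vec (A *\<^sub>v x + g)"
    then have i: "i < m" using d by simp
    have "[(A *\<^sub>v x') $ i - v $ i + g' $ i =
      (A *\<^sub>v x) $ i + (A *\<^sub>v s) $ i - ((A *\<^sub>v s) $ i + e $ i) + (g $ i + e $ i)] (mod int q)"
      using shift_mult[OF assms(1,2) i] v[OF i] i d xg
      by (intro cong_add cong_diff) (auto simp: cong_def)
    then show "[(A *\<^sub>v x' - v + g') $ i = (A *\<^sub>v x + g) $ i] (mod int q)"
      using i d dv by simp
  qed (use d in simp)
qed

lemma base_eq_iff:
  assumes "x \<in> Zvec q n" "g \<in> short" "x' \<in> Zvec q n" "g' \<in> short"
  shows "(A *\<^sub>v x' + g') vmod q = (A *\<^sub>v x + g) vmod q \<longleftrightarrow> x' = x \<and> g' = g"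
proof
  assume eq: "(A *\<^sub>v x' + g') vmod q = (A *\<^sub>v x + g) vmod q"
  then have x: "x' = x" using recover'[OF assms(1,2)] recover'[OF assms(3,4)] by metis
  have d: "dim_vec g = m" "dim_vec g' = m" using assms short_Zvec Zvec_dim by blast+
  have "g' = g"
  proof (rule Zvec_eqI[OF short_Zvec[OF assms(4)] short_Zvec[OF assms(2)]])
    fix i assume "i < m"
    then show "[g' $ i = g $ i] (mod int q)"
      using vmod_eqD[OF eq, of i] d by (simp add: x cong_add_lcancel)
  qed
  with x show "x' = x \<and> g' = g" by simp
qed simp

text \<open>Membership in the second set says that \<open>y\<close> also arises in the branch
  \<open>c = 1\<close>; by \<open>lift_eq_iff\<close> the noise there is \<open>g + e\<close>, which
  must then be short too.\<close>

lemma no_abort_iff: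
  assumes "s \<in> Zvec q n" "e \<in> short"
  shows "alice_no_abort q n m \<tau> A ((A *\<^sub>v s + e) vmod q) y \<longleftrightarrow>
    y \<in> (\<lambda>(x, g). (A *\<^sub>v x + g) vmod q) ` accepted e" (is "?L \<longleftrightarrow> ?R")
proof
  assume ?L
  then obtain x g x' g' where xg: "x \<in> Zvec q n" "g \<in> short" "y = (A *\<^sub>v x + g) vmod q"
    "x' \<in> Zvec q n" "g' \<in> short" "y = (A *\<^sub>v x' - ((A *\<^sub>v s + e) vmod q) + g') vmod q"
    unfolding alice_no_abort_def by blast
  then have "g' = (g + e) vmod q" using lift_eq_iff[OF xg(1) assms xg(2,5,4)] by simp
  then show ?R using xg by (auto simp: accepted_def)
next
  assume ?R
  then obtain x g where xg: "x \<in> Zvec q n" "g \<in> short" "(g + e) vmod q \<in> short" "y = (A *\<^sub>v x + g) vmod q"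
    by (auto simp: accepted_def)
  have x': "(x + s) vmod q \<in> Zvec q n"
    using xg assms by (intro vmod_in_Zvec q_pos) (auto simp: Zvec_def)
  have "y = (A *\<^sub>v ((x + s) vmod q) - ((A *\<^sub>v s + e) vmod q) + ((g + e) vmod q)) vmod q"
    using lift_eq_iff[OF xg(1) assms xg(2,3) x'] xg(4) by simp
  then show ?L unfolding alice_no_abort_def using xg x' by blast
qed

text \<open>Allows acceptance probabilities to be summed over pairs instead of outcomes.\<close>

lemma inj_on_accepted: "inj_on (\<lambda>(x, g). (A *\<^sub>v x + g) vmod q) (accepted e)"
proof (rule inj_onI, clarsimp simp: accepted_def)
  fix x g x' g'
  assume "x \<in> Zvec q n" "g \<in> short" "x' \<in> Zvec q n" "g' \<in> short"
    and "(A *\<^sub>v x + g) vmod q = (A *\<^sub>v x' + g') vmod q"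
  then show "x = x' \<and> g = g'" using base_eq_iff[of x' g' x g] by blast
qed

end

subsection \<open>Amplitudes of the prepared state\<close>

lemma sum_lessThan_add: "(\<Sum>k<a + b. f k) = (\<Sum>k<a. f k) + (\<Sum>j<b. f (a + j :: nat) :: 'a :: comm_monoid_add)"
  by (induction b) (auto simp: add.assoc)

text \<open>Bob's angles are made for this: their powers of 2 reassemble each coordinate of
  \<open>x\<close> from its bits.\<close>

lemma sum_bits_times_angle:
  assumes "x \<in> Zvec q n" "q \<le> 2 ^ Q" "dim_vec a = n"
  shows "(\<Sum>k<n * Q. of_bool (binary_vec Q x ! k) * bob_angle q Q a k)
    = 2 * pi * real_of_int (a \<bullet> x) / real q"
proof -
  have dim: "dim_vec x = n" using assms Zvec_dim by auto
  have range: "x $ i \<in> {0..<2 ^ Q}" if "i < n" for i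
    using Zvec_index[OF assms(1) that] assms(2)
    by (auto intro: less_le_trans simp: numeral_power_le_of_nat_cancel_iff)
  let ?f = "\<lambda>k. of_bool (binary_vec Q x ! k) * bob_angle q Q a k"
  have block: "(\<Sum>j<Q. ?f (i * Q + j)) = 2 * pi / real q * real_of_int (a $ i * x $ i)" if i: "i < n" for i
  proof -
    have "?f (i * Q + j) = 2 * pi / real q * real_of_int (a $ i) * real_of_int (of_bool (bit (x $ i) j) * 2 ^ j)"
      if j: "j < Q" for j
    proof -
      have "i * Q + j < dim_vec x * Q"
        using i j mult_le_mono1[of "Suc i" n Q] dim by simp
      then show ?thesis
        using j by (auto simp: binary_vec_nth bob_angle_def)
    qed
    then have "(\<Sum>j<Q. ?f (i * Q + j)) =
      2 * pi / real q * real_of_int (a $ i) * real_of_int (\<Sum>j<Q. of_bool (bit (x $ i) j) * 2 ^ j)"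
      by (simp only: sum_distrib_left of_int_sum) (intro sum.cong, auto)
    then show ?thesis by (simp only: bit_sum[OF range[OF i]] of_int_mult mult.assoc)
  qed
  have "(\<Sum>k<d * Q. ?f k) = (\<Sum>i<d. \<Sum>j<Q. ?f (i * Q + j))" for d
  proof (induction d)
    case (Suc d)
    have "(\<Sum>k<d * Q + Q. ?f k) = (\<Sum>k<d * Q. ?f k) + (\<Sum>j<Q. ?f (d * Q + j))"
      by (rule sum_lessThan_add)
    with Suc show ?case by (simp add: add.commute)
  qed simp
  then have "(\<Sum>k<n * Q. ?f k) = (\<Sum>i<n. 2 * pi / real q * real_of_int (a $ i * x $ i))"
    using block by simp
  also have "\<dots> = 2 * pi / real q * real_of_int (\<Sum>i<n. a $ i * x $ i)"
    by (simp only: sum_distrib_left of_int_sum)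
  finally show ?thesis by (simp add: scalar_prod_def dim lessThan_atLeast0)
qed

text \<open>On bits, \<open>x + y = (x xor y) + 2 (x and y)\<close>, so the exponents have the same
  parity.\<close>

lemma minus_one_power_bdot_bxor:
  assumes "length xs = N" "length ys = N"
  shows "(- 1 :: 'a :: ring_1) ^ bdot (bxor xs ys) u =
    (- 1) ^ (\<Sum>k<N. of_bool (xs ! k) * of_bool (u ! k)) *
    (- 1) ^ (\<Sum>k<N. of_bool (ys ! k) * of_bool (u ! k))"
proof -
  let ?D = "\<Sum>k<N. of_bool (xs ! k \<noteq> ys ! k) * of_bool (u ! k) :: nat"
  have eq: "(\<Sum>k<N. of_bool (xs ! k) * of_bool (u ! k)) + (\<Sum>k<N. of_bool (ys ! k) * of_bool (u ! k))
    = ?D + 2 * (\<Sum>k<N. of_bool (xs ! k \<and> ys ! k) * of_bool (u ! k))"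
    unfolding sum_distrib_left sum.distrib[symmetric] by (intro sum.cong) auto
  have parity: "even D = even (a + b)" if "a + b = D + 2 * c" for a b c D :: nat
    using that by simp
  have "even ?D \<longleftrightarrow>
    even ((\<Sum>k<N. of_bool (xs ! k) * of_bool (u ! k)) + (\<Sum>k<N. of_bool (ys ! k) * of_bool (u ! k)) :: nat)"
    by (rule parity[OF eq])
  moreover have "bdot (bxor xs ys) u = ?D mod 2"
    using assms unfolding bdot_def bxor_def by (intro arg_cong2[where f = "(mod)"] sum.cong) auto
  ultimately show ?thesis
    unfolding power_add[symmetric] by (simp add: minus_one_power_iff)
qed

lemma cis_cong:
  assumes "[k = k'] (mod int q)" "q > 0"
  shows "cis (2 * pi * real_of_int k / real q) = cis (2 * pi * real_of_int k' / real q)"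
proof -
  obtain j where "k' = k + int q * j" using assms(1) by (metis cong_iff_lin)
  then have "2 * pi * real_of_int k' / real q = 2 * pi * real_of_int k / real q + 2 * pi * real_of_int j"
    using assms(2) by (simp add: field_simps)
  then show ?thesis by (simp add: cis_mult[symmetric] cis_multiple_2pi)
qed

lemma alice_ket_eq:
  assumes "b < 2"
  shows "alice_ket q \<alpha> b = phase_ket 1 ((- 1) ^ b * cis (2 * pi * real_of_int \<alpha> / real q))"
proof -
  have e: "exp (2 * pi * \<i> * of_int \<alpha> / of_nat q) = cis (2 * pi * real_of_int \<alpha> / real q)"
    by (simp add: cis_conv_exp mult_ac)
  have Z: "pauli_Z \<in> carrier_mat 2 2" by (simp add: pauli_Z_def mat_of_rows_list_def numeral_2_eq_2)
  from assms consider "b = 0" | "b = 1" by linarith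
  then show ?thesis
  proof cases
    case 1
    then show ?thesis using Z unfolding alice_ket_def e
      by (intro eq_vecI)
        (auto simp: phase_ket_def scalar_prod_def numeral_2_eq_2 less_Suc_eq)
  next
    case 2
    have "pauli_Z ^\<^sub>m b = pauli_Z" using 2 Z by simp
    then show ?thesis using 2 Z unfolding alice_ket_def e
      by (intro eq_vecI)
        (auto simp: phase_ket_def scalar_prod_def numeral_2_eq_2 less_Suc_eq
          pauli_Z_def mat_of_rows_list_def)
  qed
qed

section \<open>Collapse of Bob's superposition\<close>

context lwe_matrix
begin

abbreviation "triples \<equiv> bob_triples q n m \<tau>"

definition label :: "int vec \<Rightarrow> int vec \<times> bool \<times> int vec \<Rightarrow> bool list \<times> bool \<times> int vec" where
  "label v = (\<lambda>(x, c, g). (binary_vec Q x, c, (A *\<^sub>v x - of_bool c \<cdot>\<^sub>v v + g) vmod q))"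

lemma label_simps:
  assumes "dim_vec v = m" "dim_vec g = m"
  shows "label v (x, False, g) = (binary_vec Q x, False, (A *\<^sub>v x + g) vmod q)"
    and "label v (x, True, g) = (binary_vec Q x, True, (A *\<^sub>v x - v + g) vmod q)"
  using assms by (auto simp: label_def intro!: vmod_eqI)

lemma finite_triples: "finite triples"
  by (simp add: bob_triples_def finite_Zvec finite_short_vecs)

lemma zero_short: "0\<^sub>v m \<in> short"
  using tau_nonneg q_pos m_pos by (auto simp: short_vecs_eq zabs_def)

lemma card_triples: "card triples = card (Zvec q n) * (2 * card short)"
  and card_triples_pos: "card triples > 0"
  using zero_short Zvec_nonempty[OF q_pos, of n]
  by (auto simp: bob_triples_def card_cartesian_product finite_Zvec finite_short_vecs card_gt_0_iff)

text \<open>The first two registers reveal \<open>x\<close> and \<open>c\<close>, and cancellation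
  in the third reveals \<open>g\<close>. Thus triples do not interfere, and their number is the
  correct normalization.\<close>

lemma inj_on_label:
  assumes "dim_vec v = m"
  shows "inj_on (label v) triples"
proof (rule inj_onI, clarsimp simp: bob_triples_def)
  fix x c g x' c' g'
  assume xg: "x \<in> Zvec q n" "g \<in> short" "x' \<in> Zvec q n" "g' \<in> short"
    and eq: "label v (x, c, g) = label v (x', c', g')"
  then have x: "x = x'" "c = c'"
    using inj_onD[OF inj_on_binary_vec[OF q_le]] by (auto simp: label_def)
  have d: "dim_vec g = m" "dim_vec g' = m" using xg short_Zvec Zvec_dim by blast+
  have vm: "(A *\<^sub>v x - of_bool c \<cdot>\<^sub>v v + g) vmod q = (A *\<^sub>v x - of_bool c \<cdot>\<^sub>v v + g') vmod q"
    using eq x by (simp add: label_def)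
  have "g = g'"
  proof (rule Zvec_eqI[OF short_Zvec[OF xg(2)] short_Zvec[OF xg(4)]])
    fix i assume "i < m"
    then show "[g $ i = g' $ i] (mod int q)"
      using vmod_eqD[OF vm, of i] d assms by (simp add: cong_add_lcancel)
  qed
  with x show "x = x' \<and> c = c' \<and> g = g'" by simp
qed

lemma bob_phi_eq:
  assumes "dim_vec v = m"
  shows "bob_phi q Q n m \<tau> A v lbl =
    of_bool (lbl \<in> label v ` triples) / complex_of_real (sqrt (real (card triples)))"
proof -
  have "(\<Sum>(x, c, g)\<in>triples.
      if lbl = (binary_vec Q x, c, (A *\<^sub>v x - of_bool c \<cdot>\<^sub>v v + g) vmod q) then 1 else 0 :: complex)
    = (\<Sum>t\<in>triples. if lbl = label v t then 1 else 0)"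
    by (intro sum.cong) (auto simp: label_def)
  also have "\<dots> = (\<Sum>l\<in>label v ` triples. if lbl = l then 1 else 0)"
    by (simp add: sum.reindex[OF inj_on_label[OF assms]])
  also have "\<dots> = of_bool (lbl \<in> label v ` triples)"
    by (simp add: finite_triples sum.delta')
  finally show ?thesis by (simp add: bob_phi_def)
qed

abbreviation "basis \<equiv> bitstrings (n * Q) \<times> (UNIV :: bool set)"

abbreviation "bob_residual v \<equiv> \<lambda>y (bs, c). bob_phi q Q n m \<tau> A v (bs, c, y)"

text \<open>Every label has probability one over the number of triples, and summing over outcomes
  and basis states meets each label exactly once.\<close>

lemma sum_sq_norm_bob_residual:
  assumes "dim_vec v = m"
  shows "(\<Sum>y\<in>Zvec q m. sq_norm basis (bob_residual v y)) = 1"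
proof -
  let ?I = "label v ` triples"
  have "(\<Sum>y\<in>Zvec q m. sq_norm basis (bob_residual v y))
    = (\<Sum>y\<in>Zvec q m. \<Sum>b\<in>basis. of_bool ((fst b, snd b, y) \<in> ?I) / real (card triples))"
    unfolding sq_norm_def
    by (intro sum.cong) (auto simp: bob_phi_eq[OF assms] norm_divide power_divide of_bool_def)
  also have "\<dots> = (\<Sum>p\<in>Zvec q m \<times> basis. of_bool ((fst (snd p), snd (snd p), fst p) \<in> ?I) / real (card triples))"
    by (simp add: sum.cartesian_product case_prod_beta)
  also have "\<dots> = real (card ((Zvec q m \<times> basis) \<inter> {p. (fst (snd p), snd (snd p), fst p) \<in> ?I})) / real (card triples)"
    by (simp add: sum_divide_distrib[symmetric] sum_of_bool_eq finite_Zvec finite_bitstrings)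
  also have "card ((Zvec q m \<times> basis) \<inter> {p. (fst (snd p), snd (snd p), fst p) \<in> ?I}) = card ?I"
  proof (rule bij_betw_same_card)
    have "l \<in> bitstrings (n * Q) \<times> UNIV \<times> Zvec q m" if in_I: "l \<in> ?I" for l
    proof -
      obtain x c g where l: "l = label v (x, c, g)" and "x \<in> Zvec q n" "g \<in> short"
        using in_I by (auto simp: bob_triples_def)
      moreover have "dim_vec x = n" "dim_vec g = m"
        using calculation short_Zvec Zvec_dim by blast+
      ultimately show ?thesis using q_pos
        by (auto simp: label_def bitstrings_def length_binary_vec intro!: vmod_in_Zvec carrier_vecI)
    qed
    then show "bij_betw (\<lambda>p. (fst (snd p), snd (snd p), fst p))
      ((Zvec q m \<times> basis) \<inter> {p. (fst (snd p), snd (snd p), fst p) \<in> ?I}) ?I"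
      by (intro bij_betw_byWitness[where f' = "\<lambda>(bs, c, y). (y, bs, c)"] subsetI ballI)
        (auto simp del: image_iff)
  qed
  also have "card ?I = card triples" by (rule card_image[OF inj_on_label[OF assms]])
  finally show ?thesis using card_triples_pos by simp
qed

definition branch :: "int vec \<Rightarrow> int vec \<Rightarrow> bool \<Rightarrow> int vec" where
  "branch s x c = (if c then (x + s) vmod q else x)"

lemma branch_Zvec: "x \<in> Zvec q n \<Longrightarrow> s \<in> Zvec q n \<Longrightarrow> branch s x c \<in> Zvec q n"
  by (auto simp: branch_def intro!: vmod_in_Zvec q_pos) (auto simp: Zvec_def)

lemma branch_bitstring:
  "x \<in> Zvec q n \<Longrightarrow> s \<in> Zvec q n \<Longrightarrow> binary_vec Q (branch s x c) \<in> bitstrings (n * Q)"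
  using branch_Zvec[of x s c] by (simp add: bitstrings_def length_binary_vec Zvec_dim)

text \<open>\<open>base_eq_iff\<close> leaves one preimage of the outcome for \<open>c = 0\<close>,
  and \<open>lift_eq_iff\<close> one for \<open>c = 1\<close>. Acceptance makes the noise of the
  latter short, so that this branch is really present.\<close>

lemma bob_phi_accepted:
  assumes "s \<in> Zvec q n" "e \<in> short" "(x, g) \<in> accepted e"
  defines "v \<equiv> (A *\<^sub>v s + e) vmod q"
  shows "bob_phi q Q n m \<tau> A v (bs, c, (A *\<^sub>v x + g) vmod q) =
    of_bool (bs = binary_vec Q (branch s x c)) / complex_of_real (sqrt (real (card triples)))"
proof -
  have xg: "x \<in> Zvec q n" "g \<in> short" "(g + e) vmod q \<in> short"
    using assms by (auto simp: accepted_def)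
  have dim: "dim_vec g = m" if "g \<in> short" for g using that short_Zvec Zvec_dim by blast
  have v: "dim_vec v = m" using dim[OF assms(2)] by (simp add: v_def)
  have "(bs, c, (A *\<^sub>v x + g) vmod q) \<in> label v ` triples \<longleftrightarrow> bs = binary_vec Q (branch s x c)"
  proof
    assume "(bs, c, (A *\<^sub>v x + g) vmod q) \<in> label v ` triples"
    then obtain x' g' where "x' \<in> Zvec q n" "g' \<in> short"
      and l: "(bs, c, (A *\<^sub>v x + g) vmod q) = label v (x', c, g')"
      by (auto simp: bob_triples_def label_def)
    note xg' = \<open>x' \<in> Zvec q n\<close> \<open>g' \<in> short\<close>
    show "bs = binary_vec Q (branch s x c)"
    proof (cases c)
      case True
      with l have "bs = binary_vec Q x'" "(A *\<^sub>v x' - v + g') vmod q = (A *\<^sub>v x + g) vmod q"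
        by (simp_all add: label_simps(2)[OF v dim[OF xg'(2)]])
      then show ?thesis
        using lift_eq_iff[OF xg(1) assms(1,2) xg(2) xg'(2,1), folded v_def] True
        by (simp add: branch_def)
    next
      case False
      with l have "bs = binary_vec Q x'" "(A *\<^sub>v x' + g') vmod q = (A *\<^sub>v x + g) vmod q"
        by (simp_all add: label_simps(1)[OF v dim[OF xg'(2)]])
      then show ?thesis using base_eq_iff[OF xg(1,2) xg'] False by (simp add: branch_def)
    qed
  next
    assume bs: "bs = binary_vec Q (branch s x c)"
    let ?g = "if c then (g + e) vmod q else g"
    have g: "?g \<in> short" using xg by simp
    have x': "(x + s) vmod q \<in> Zvec q n" using branch_Zvec[OF xg(1) assms(1), of True] by (simp add: branch_def)
    have "(bs, c, (A *\<^sub>v x + g) vmod q) = label v (branch s x c, c, ?g)"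
    proof (cases c)
      case True
      have "(A *\<^sub>v ((x + s) vmod q) - v + ((g + e) vmod q)) vmod q = (A *\<^sub>v x + g) vmod q"
        using lift_eq_iff[OF xg(1) assms(1,2) xg(2,3) x'] by (simp add: v_def)
      then show ?thesis
        using label_simps(2)[OF v dim[OF xg(3)]] True by (simp add: branch_def bs)
    next
      case False
      then show ?thesis using label_simps(1)[OF v dim[OF xg(2)]] by (simp add: branch_def bs)
    qed
    then show "(bs, c, (A *\<^sub>v x + g) vmod q) \<in> label v ` triples"
      using g branch_Zvec[OF xg(1) assms(1)] by (intro image_eqI) (auto simp: bob_triples_def)
  qed
  then show ?thesis by (simp add: bob_phi_eq[OF v])
qed

text \<open>One string survives for each value of \<open>c\<close>. As all accepted outcomes are
  equally likely, acceptance becomes a counting problem.\<close>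

lemma sq_norm_accepted:
  assumes "s \<in> Zvec q n" "e \<in> short" "(x, g) \<in> accepted e"
  shows "sq_norm basis (bob_residual ((A *\<^sub>v s + e) vmod q) ((A *\<^sub>v x + g) vmod q)) = 2 / real (card triples)"
proof -
  have x: "x \<in> Zvec q n" using assms by (simp add: accepted_def)
  have "sq_norm basis (bob_residual ((A *\<^sub>v s + e) vmod q) ((A *\<^sub>v x + g) vmod q)) =
    (\<Sum>bs\<in>bitstrings (n * Q). \<Sum>c\<in>UNIV.
      of_bool (bs = binary_vec Q (branch s x c)) / real (card triples))"
    unfolding sq_norm_def sum.cartesian_product
    by (intro sum.cong) (auto simp: bob_phi_accepted[OF assms] norm_divide power_divide)
  also have "\<dots> = (\<Sum>c\<in>UNIV. \<Sum>bs\<in>bitstrings (n * Q).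
      if bs = binary_vec Q (branch s x c) then 1 / real (card triples) else 0)"
    by (subst sum.swap) (intro sum.cong, auto)
  also have "\<dots> = (\<Sum>c\<in>(UNIV :: bool set). 1 / real (card triples))"
    using branch_bitstring[OF x assms(1)] by (simp add: finite_bitstrings)
  finally show ?thesis by (simp add: UNIV_bool)
qed

text \<open>The size of \<open>Zvec q n\<close> cancels, and the 2 for the surviving branches
  cancels the 2 in the number of triples.\<close>

lemma card_accepted:
  assumes "e \<in> short"
  shows "2 * real (card (accepted e)) / real (card triples) =
    (\<Prod>i<m. 1 - real_of_int (zabs q (e $ i)) / (2 * real_of_int \<lfloor>\<tau>\<rfloor> + 1))"
proof -
  let ?M = "2 * real_of_int \<lfloor>\<tau>\<rfloor> + 1"
  have M: "?M > 0" using tau_nonneg by (simp add: add_nonneg_pos)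
  have Z: "real (card (Zvec q n)) > 0"
    using Zvec_nonempty[OF q_pos] by (simp add: card_gt_0_iff finite_Zvec)
  have "2 * real (card (accepted e)) / real (card triples) =
     real (card {g \<in> short. (g + e) vmod q \<in> short}) / real (card short)"
    using Z by (simp add: accepted_def card_cartesian_product card_triples)
  also have "\<dots> = (\<Prod>i<m. ?M - real_of_int (zabs q (e $ i))) / (\<Prod>i<m. ?M)"
    using card_short_vecs_shift[OF assms tau_less m_pos] card_short_vecs[OF tau_nonneg tau_less m_pos]
    by simp
  also have "\<dots> = (\<Prod>i<m. 1 - real_of_int (zabs q (e $ i)) / ?M)"
    unfolding prod_dividef[symmetric] using M by (intro prod.cong) (auto simp: diff_divide_distrib)
  finally show ?thesis .
qed

end

subsection \<open>The final state\<close>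

context lwe_matrix
begin

text \<open>The value depends on \<open>e\<close> alone, which lets the other random choices drop
  out of the averaging.\<close>

lemma bob_accept_prob:
  assumes "s \<in> Zvec q n" "e \<in> short"
  defines "v \<equiv> (A *\<^sub>v s + e) vmod q"
  shows "(\<integral>\<^sup>+z. indicator {(y, u, \<beta>). alice_no_abort q n m \<tau> A v y} z \<partial>bob q Q n m \<tau> A v a w)
    = ennreal (\<Prod>i<m. 1 - real_of_int (zabs q (e $ i)) / (2 * real_of_int \<lfloor>\<tau>\<rfloor> + 1))"
proof -
  let ?acc = "(\<lambda>(x, g). (A *\<^sub>v x + g) vmod q) ` accepted e"
  have fin: "finite (accepted e)" by (simp add: accepted_def finite_Zvec finite_short_vecs)
  have v: "dim_vec v = m" using Zvec_dim[OF short_Zvec[OF assms(2)]] by (simp add: v_def)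
  obtain p where p: "measurement basis (Zvec q m) (bob_residual v) =
      map_pmf (\<lambda>y. (y, \<lambda>b. bob_residual v y b / complex_of_real (sqrt (sq_norm basis (bob_residual v y))))) p"
    and pmf_p: "\<And>y. pmf p y = (if y \<in> Zvec q m then sq_norm basis (bob_residual v y) else 0)"
    by (rule measurement_eq[OF finite_Zvec sum_sq_norm_bob_residual[OF v]]) (rule that)
  \<comment> \<open>The qubit measurement and the phase gate leave \<open>y\<close> unchanged, so
    they integrate to 1.\<close>
  have "(\<integral>\<^sup>+z. indicator {(y, u, \<beta>). alice_no_abort q n m \<tau> A v y} z \<partial>bob q Q n m \<tau> A v a w)
    = (\<integral>\<^sup>+y. indicator {y. alice_no_abort q n m \<tau> A v y} y \<partial>p)"
    unfolding bob_def p by (simp add: case_prod_beta indicator_def Let_def)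
  also have "\<dots> = ennreal (measure p ?acc)"
    using no_abort_iff[OF assms(1,2)] by (simp add: v_def measure_pmf.emeasure_eq_measure)
  also have "measure p ?acc = (\<Sum>y\<in>?acc. pmf p y)"
    using fin by (intro measure_measure_pmf_finite) auto
  also have "\<dots> = (\<Sum>(x, g)\<in>accepted e. pmf p ((A *\<^sub>v x + g) vmod q))"
    by (subst sum.reindex[OF inj_on_accepted]) (simp add: case_prod_beta)
  also have "\<dots> = (\<Sum>(x, g)\<in>accepted e. 2 / real (card triples))"
  proof (rule sum.cong[OF refl], clarify)
    fix x g assume xg: "(x, g) \<in> accepted e"
    have "(A *\<^sub>v x + g) vmod q \<in> Zvec q m"
      using xg Zvec_dim[OF short_Zvec] by (intro vmod_in_Zvec q_pos carrier_vecI) (auto simp: accepted_def)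
    then show "pmf p ((A *\<^sub>v x + g) vmod q) = 2 / real (card triples)"
      using sq_norm_accepted[OF assms(1,2) xg] by (simp add: pmf_p v_def)
  qed
  also have "\<dots> = 2 * real (card (accepted e)) / real (card triples)" by simp
  finally show ?thesis by (simp only: card_accepted[OF assms(2)])
qed

text \<open>What the two branches share becomes the global phase \<open>\<kappa>\<close>; the
  relative phase is the quotient of their bit phases, corrected by \<open>w\<close>.\<close>

lemma bob_output:
  assumes "s \<in> Zvec q n" "e \<in> short"
  defines "v \<equiv> (A *\<^sub>v s + e) vmod q"
  assumes "(y, u, \<beta>) \<in> set_pmf (bob q Q n m \<tau> A v a w)" "alice_no_abort q n m \<tau> A v y"
  defines "\<Phi> \<equiv> bit_phase (n * Q) (bob_angle q Q a) u"
  obtains x \<kappa> where "x \<in> Zvec q n" "recover y = x" "cmod \<kappa> = 1"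
    "\<beta> = phase_ket \<kappa> (cis (2 * pi * real_of_int w / real q) *
       \<Phi> (binary_vec Q (branch s x True)) / \<Phi> (binary_vec Q (branch s x False)))"
proof -
  let ?r = "bob_angle q Q a" and ?N = "n * Q"
  have v: "dim_vec v = m" using Zvec_dim[OF short_Zvec[OF assms(2)]] by (simp add: v_def)
  obtain p where p: "measurement basis (Zvec q m) (bob_residual v) =
      map_pmf (\<lambda>y. (y, \<lambda>b. bob_residual v y b / complex_of_real (sqrt (sq_norm basis (bob_residual v y))))) p"
    by (rule measurement_eq[OF finite_Zvec sum_sq_norm_bob_residual[OF v]])
  define \<psi> where "\<psi> = (\<lambda>b. bob_residual v y b / complex_of_real (sqrt (sq_norm basis (bob_residual v y))))"
  obtain \<psi>' where \<psi>': "(u, \<psi>') \<in> set_pmf (measurement UNIV (bitstrings ?N) (measure_qubits_residual ?N ?r \<psi>))"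
    and \<beta>: "\<beta> = phase_gate (2 * pi * real_of_int w / real q) *\<^sub>v vec 2 (\<lambda>i. \<psi>' (i = 1))"
    using assms(4) unfolding bob_def p by (auto simp: Let_def \<psi>_def)
  obtain x g where xg: "(x, g) \<in> accepted e" and y: "y = (A *\<^sub>v x + g) vmod q"
    using assms(5) no_abort_iff[OF assms(1,2)] by (auto simp: v_def)
  have x: "x \<in> Zvec q n" "recover y = x"
    using xg recover' by (auto simp: accepted_def y)
  let ?X = "\<lambda>c. binary_vec Q (branch s x c)"
  have X: "?X c \<in> bitstrings ?N" for c by (rule branch_bitstring[OF x(1) assms(1)])
  have \<psi>: "\<psi> = (\<lambda>(bs, c). of_bool (bs = ?X c) * complex_of_real (1 / sqrt 2))"
    using card_triples_pos bob_phi_accepted[OF assms(1,2) xg] sq_norm_accepted[OF assms(1,2) xg]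
    by (auto simp: \<psi>_def y v_def real_sqrt_divide fun_eq_iff)
  have "\<exists>K. cmod K = 1 / sqrt 2 ^ ?N \<and> (\<forall>c. measure_qubits_residual ?N ?r \<psi> u c =
      K * complex_of_real (1 / sqrt 2) * bit_phase ?N ?r u (?X c))" for u
    using measure_qubits_residual_cat[OF \<psi> X] by metis
  then obtain K where K: "\<And>u. cmod (K u) = 1 / sqrt 2 ^ ?N"
    "\<And>u c. measure_qubits_residual ?N ?r \<psi> u c =
      K u * complex_of_real (1 / sqrt 2) * bit_phase ?N ?r u (?X c)"
    by metis
  \<comment> \<open>The weight is independent of \<open>u\<close>, so the outcomes are uniform on
    the \<open>2 ^ (n * Q)\<close> strings.\<close>
  have sq: "sq_norm UNIV (measure_qubits_residual ?N ?r \<psi> u) = 1 / 2 ^ ?N" for u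
    unfolding sq_norm_bool K(2) norm_mult norm_bit_phase K(1)
    by (simp add: power_mult_distrib power_divide power_even_eq[symmetric] power_mult[symmetric])
      (simp add: power_mult mult.commute[of _ 2] norm_divide power_divide)
  have "(\<Sum>u\<in>bitstrings ?N. sq_norm UNIV (measure_qubits_residual ?N ?r \<psi> u)) = 1"
    by (simp add: sq card_bitstrings)
  then obtain p' where "measurement UNIV (bitstrings ?N) (measure_qubits_residual ?N ?r \<psi>) =
    map_pmf (\<lambda>u. (u, \<lambda>b. measure_qubits_residual ?N ?r \<psi> u b /
      complex_of_real (sqrt (sq_norm UNIV (measure_qubits_residual ?N ?r \<psi> u))))) p'"
    by (rule measurement_eq[OF finite_bitstrings])
  then have \<psi>'_eq: "\<psi>' c = K u * complex_of_real (sqrt 2 ^ ?N) * \<Phi> (?X c) / complex_of_real (sqrt 2)" for c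
    using \<psi>' unfolding sq by (auto simp: K(2) real_sqrt_divide real_sqrt_power \<Phi>_def)
  define \<kappa> where "\<kappa> = K u * complex_of_real (sqrt 2 ^ ?N) * \<Phi> (?X False)"
  have nz: "\<Phi> bs \<noteq> 0" for bs using norm_bit_phase[of ?N ?r u bs] by (auto simp: \<Phi>_def)
  have "cmod \<kappa> = 1" by (simp add: \<kappa>_def norm_mult K(1) \<Phi>_def norm_bit_phase norm_power)
  moreover have "\<beta> = phase_ket \<kappa> (cis (2 * pi * real_of_int w / real q) * \<Phi> (?X True) / \<Phi> (?X False))"
    unfolding \<beta>
    by (rule eq_vecI) (auto simp: phase_ket_def phase_gate_def mat_of_rows_list_def less_Suc_eq
        numeral_2_eq_2 scalar_prod_def \<psi>'_eq \<kappa>_def cis_conv_exp nz)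
  ultimately show thesis by (intro that[OF x])
qed

text \<open>Transposition gives \<open><a, s> = <f, A s>\<close> mod q, so the secret cancels. The
  noise enters through its centered representative because the remaining angle has to be small as a
  real number.\<close>

lemma angle_cong:
  assumes "s \<in> Zvec q n" "e \<in> short" "x \<in> Zvec q n" "f \<in> Zvec 2 m"
  defines "v \<equiv> (A *\<^sub>v s + e) vmod q" and "a \<equiv> (transpose_mat A *\<^sub>v f) vmod q"
  shows "[(f \<bullet> v + \<alpha>) mod int q - a \<bullet> branch s x True + a \<bullet> x
    = \<alpha> + f \<bullet> map_vec (centered q) e] (mod int q)"
proof -
  have d: "dim_vec s = n" "dim_vec e = m" "dim_vec x = n" "dim_vec f = m"
    using assms(1-4) Zvec_dim short_Zvec by blast+
  then have c: "s \<in> carrier_vec n" "e \<in> carrier_vec m" "x \<in> carrier_vec n" "f \<in> carrier_vec m"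
    by (auto intro: carrier_vecI)
  have a: "a \<in> carrier_vec n" by (auto simp: a_def intro!: carrier_vecI)
  have "[a \<bullet> branch s x True = a \<bullet> (x + s)] (mod int q)"
    using d by (intro scalar_prod_cong) (auto simp: branch_def cong_def)
  also have "a \<bullet> (x + s) = a \<bullet> x + s \<bullet> a"
    using a c by (simp add: scalar_prod_add_distrib[of _ n] comm_scalar_prod[of a n s])
  also have "[a \<bullet> x + s \<bullet> a = a \<bullet> x + s \<bullet> (transpose_mat A *\<^sub>v f)] (mod int q)"
    by (intro cong_add cong_refl scalar_prod_cong) (auto simp: a_def cong_def)
  also have "s \<bullet> (transpose_mat A *\<^sub>v f) = f \<bullet> (A *\<^sub>v s)"
    using transpose_vec_mult_scalar[OF A_carrier c(1,4)] c A_carrier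
      comm_scalar_prod[of s n "transpose_mat A *\<^sub>v f"] by simp
  finally have ax: "[a \<bullet> branch s x True = a \<bullet> x + f \<bullet> (A *\<^sub>v s)] (mod int q)" .
  have "[f \<bullet> v = f \<bullet> (A *\<^sub>v s + e)] (mod int q)"
    by (intro scalar_prod_cong) (auto simp: v_def cong_def)
  also have "f \<bullet> (A *\<^sub>v s + e) = f \<bullet> (A *\<^sub>v s) + f \<bullet> e"
    using c A_carrier by (intro scalar_prod_add_distrib[of _ m]) auto
  also have "[f \<bullet> (A *\<^sub>v s) + f \<bullet> e = f \<bullet> (A *\<^sub>v s) + f \<bullet> map_vec (centered q) e] (mod int q)"
    by (intro cong_add cong_refl scalar_prod_cong) (auto intro: cong_sym[OF centered_cong])
  finally have fv: "[f \<bullet> v = f \<bullet> (A *\<^sub>v s) + f \<bullet> map_vec (centered q) e] (mod int q)" .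
  have "[(f \<bullet> v + \<alpha>) mod int q - a \<bullet> branch s x True + a \<bullet> x =
     (f \<bullet> (A *\<^sub>v s) + f \<bullet> map_vec (centered q) e + \<alpha>) - (a \<bullet> x + f \<bullet> (A *\<^sub>v s)) + a \<bullet> x] (mod int q)"
    using fv by (intro cong_add cong_diff cong_refl ax) (auto simp: cong_def mod_simps intro: mod_add_cong)
  then show ?thesis by (simp add: algebra_simps)
qed

lemma trace_distance_le:
  assumes "s \<in> Zvec q n" "e \<in> short" "f \<in> Zvec 2 m"
  defines "v \<equiv> (A *\<^sub>v s + e) vmod q" and "a \<equiv> (transpose_mat A *\<^sub>v f) vmod q"
  assumes "(y, u, \<beta>) \<in> set_pmf (bob q Q n m \<tau> A v a ((f \<bullet> v + \<alpha>) mod int q))"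
    "alice_no_abort q n m \<tau> A v y"
    and b: "b = bdot (bxor (binary_vec Q (recover y)) (binary_vec Q ((recover y + s) vmod q))) u"
  shows "trace_norm (ketbra (alice_ket q \<alpha> b) - ketbra \<beta>)
    \<le> 2 * pi / real q * real_of_int (\<Sum>i<m. zabs q (e $ i))"
proof -
  let ?w = "(f \<bullet> v + \<alpha>) mod int q" and ?N = "n * Q"
  let ?\<Phi> = "bit_phase ?N (bob_angle q Q a) u"
  obtain x \<kappa> where x: "x \<in> Zvec q n" "recover y = x" and \<kappa>: "cmod \<kappa> = 1"
    and \<beta>: "\<beta> = phase_ket \<kappa> (cis (2 * pi * real_of_int ?w / real q) *
       ?\<Phi> (binary_vec Q (branch s x True)) / ?\<Phi> (binary_vec Q (branch s x False)))"
    using bob_output[OF assms(1,2) assms(6,7)[unfolded v_def]] unfolding v_def by metis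
  let ?\<theta> = "\<lambda>k :: int. 2 * pi * real_of_int k / real q"
  let ?S = "\<lambda>c. \<Sum>k<?N. of_bool (binary_vec Q (branch s x c) ! k) * of_bool (u ! k) :: nat"
  have a: "dim_vec a = n" by (simp add: a_def)
  have \<Phi>: "?\<Phi> (binary_vec Q (branch s x c)) = (- 1) ^ ?S c * cis (- ?\<theta> (a \<bullet> branch s x c))" for c
    unfolding bit_phase_eq sum_bits_times_angle[OF branch_Zvec[OF x(1) assms(1)] q_le a] ..
  have bx: "binary_vec Q x = binary_vec Q (branch s x False)"
    "binary_vec Q ((x + s) vmod q) = binary_vec Q (branch s x True)"
    by (simp_all add: branch_def)
  \<comment> \<open>The signs from the two branches multiply to the one that Alice predicts from the
    XOR of the bit strings.\<close>
  have sgn: "(- 1 :: complex) ^ b = (- 1) ^ ?S False * (- 1) ^ ?S True"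
    unfolding b x(2) bx
    by (rule minus_one_power_bdot_bxor)
      (use branch_Zvec[OF x(1) assms(1)] Zvec_dim in \<open>auto simp: length_binary_vec\<close>)
  let ?k = "?w - a \<bullet> branch s x True + a \<bullet> x"
  have inv_sgn: "inverse ((- 1 :: complex) ^ j) = (- 1) ^ j" for j by (simp add: power_inverse[symmetric])
  have "?\<theta> ?k = ?\<theta> ?w + (- ?\<theta> (a \<bullet> branch s x True)) + ?\<theta> (a \<bullet> x)"
    by (simp add: algebra_simps add_divide_distrib diff_divide_distrib)
  then have cis_k: "cis (?\<theta> ?k) =
      cis (?\<theta> ?w) * cis (- ?\<theta> (a \<bullet> branch s x True)) * cis (?\<theta> (a \<bullet> x))"
    by (simp only: cis_mult)
  have "cis (?\<theta> ?w) * ?\<Phi> (binary_vec Q (branch s x True)) / ?\<Phi> (binary_vec Q (branch s x False))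
      = (- 1) ^ b * cis (?\<theta> ?k)"
    unfolding \<Phi> sgn cis_k divide_inverse[of _ "_ * _"] inverse_mult_distrib inv_sgn cis_inverse
    by (simp add: branch_def mult_ac)
  \<comment> \<open>Only the residue mod q affects the phase, so the small representative may
    replace the one that Bob computes with.\<close>
  also have "cis (?\<theta> ?k) = cis (?\<theta> (\<alpha> + f \<bullet> map_vec (centered q) e))"
    using angle_cong[OF assms(1,2) x(1) assms(3)] q_pos unfolding v_def a_def by (intro cis_cong)
  finally have "\<beta> = phase_ket \<kappa> ((- 1) ^ b * cis (?\<theta> (\<alpha> + f \<bullet> map_vec (centered q) e)))"
    unfolding \<beta> by simp
  moreover have "b < 2" unfolding b bdot_def by simp
  ultimately have "trace_norm (ketbra (alice_ket q \<alpha> b) - ketbra \<beta>) =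
    cmod ((- 1) ^ b * cis (?\<theta> \<alpha>) - (- 1) ^ b * cis (?\<theta> (\<alpha> + f \<bullet> map_vec (centered q) e)))"
    using \<kappa> by (simp add: alice_ket_eq trace_norm_phase_kets norm_mult norm_power)
  also have "\<dots> = cmod (cis (?\<theta> \<alpha>) - cis (?\<theta> (\<alpha> + f \<bullet> map_vec (centered q) e)))"
    by (simp add: right_diff_distrib[symmetric] norm_mult norm_power)
  also have "\<dots> \<le> \<bar>?\<theta> \<alpha> - ?\<theta> (\<alpha> + f \<bullet> map_vec (centered q) e)\<bar>" by (rule norm_cis_diff_le)
  also have "?\<theta> \<alpha> - ?\<theta> (\<alpha> + f \<bullet> map_vec (centered q) e) = - (2 * pi / real q * real_of_int (f \<bullet> map_vec (centered q) e))"
    by (simp add: algebra_simps add_divide_distrib)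
  also have "\<bar>\<dots>\<bar> = 2 * pi / real q * real_of_int \<bar>f \<bullet> map_vec (centered q) e\<bar>"
    by (simp add: abs_mult)
  also have "\<dots> \<le> 2 * pi / real q * real_of_int (\<Sum>i<m. zabs q (e $ i))"
  proof (intro mult_left_mono of_int_le_iff[THEN iffD2])
    have d: "dim_vec e = m" using Zvec_dim[OF short_Zvec[OF assms(2)]] .
    have "\<bar>f \<bullet> map_vec (centered q) e\<bar> \<le> (\<Sum>i<m. \<bar>f $ i * centered q (e $ i)\<bar>)"
      unfolding scalar_prod_def using d by (simp add: lessThan_atLeast0)
    also have "\<dots> \<le> (\<Sum>i<m. zabs q (e $ i))"
    proof (rule sum_mono)
      fix i assume "i \<in> {..<m}"
      then have i: "i < m" by simp
      have "f $ i \<in> {0, 1}" using Zvec_index[OF assms(3) i] by auto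
      moreover have "\<bar>centered q (e $ i)\<bar> = zabs q (e $ i)"
        using Zvec_index[OF short_Zvec[OF assms(2)] i] by (rule abs_centered)
      ultimately show "\<bar>f $ i * centered q (e $ i)\<bar> \<le> zabs q (e $ i)" by auto
    qed
    finally show "\<bar>f \<bullet> map_vec (centered q) e\<bar> \<le> (\<Sum>i<m. zabs q (e $ i))" .
  qed simp
  finally show ?thesis .
qed

end

subsection \<open>Averaging over the noise\<close>

definition reduced_noise :: "nat \<Rightarrow> nat \<Rightarrow> real \<Rightarrow> real \<Rightarrow> int vec pmf" where
  "reduced_noise q m s t = map_pmf (\<lambda>es. vec_of_list es vmod q) (replicate_pmf m (truncated_gaussian s t))"

text \<open>The samples stay below \<open>q / 2\<close> in absolute value, so \<open>zabs\<close>
  undoes the reduction mod q.\<close>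

lemma reduced_noise_sample:
  assumes "es \<in> set_pmf (replicate_pmf m (truncated_gaussian s t))"
    and "s > 0" "0 \<le> t" "4 * t < real q" "m > 0"
  shows "vec_of_list es vmod q \<in> short_vecs q m t"
    and "(\<Sum>i<m. zabs q ((vec_of_list es vmod q) $ i)) = (\<Sum>x\<leftarrow>es. \<bar>x\<bar>)"
    and "(\<Prod>i<m. h (zabs q ((vec_of_list es vmod q) $ i))) = (\<Prod>x\<leftarrow>es. h \<bar>x\<bar> :: real)"
    and "\<And>x. x \<in> set es \<Longrightarrow> \<bar>x\<bar> \<le> \<lfloor>t\<rfloor>"
proof -
  have "set_pmf (truncated_gaussian s t) = {- \<lfloor>t\<rfloor>..\<lfloor>t\<rfloor>}"
    using nn_integral_truncated_gaussian[OF assms(2,3)] by metis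
  then have len: "length es = m" and mem: "\<And>x. x \<in> set es \<Longrightarrow> \<bar>x\<bar> \<le> \<lfloor>t\<rfloor>"
    using assms(1) by (auto simp: set_replicate_pmf abs_le_iff lists_eq_set)
  show "\<And>x. x \<in> set es \<Longrightarrow> \<bar>x\<bar> \<le> \<lfloor>t\<rfloor>" by (rule mem)
  have q: "q > 0" using assms by (cases q) auto
  have z: "zabs q ((vec_of_list es vmod q) $ i) = \<bar>es ! i\<bar>" if i: "i < m" for i
  proof -
    have "\<bar>es ! i\<bar> \<le> \<lfloor>t\<rfloor>" using mem i len by simp
    then have "2 * \<bar>es ! i\<bar> \<le> 2 * \<lfloor>t\<rfloor>" by simp
    also have "\<dots> \<le> int q" using assms(3,4) by linarith
    finally show ?thesis using zabs_mod[OF _ q] i len by (simp add: vec_of_list_index)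
  qed
  show "vec_of_list es vmod q \<in> short_vecs q m t"
    using z mem len q by (auto simp: short_vecs_eq[OF assms(5)] intro!: carrier_vecI)
  show "(\<Sum>i<m. zabs q ((vec_of_list es vmod q) $ i)) = (\<Sum>x\<leftarrow>es. \<bar>x\<bar>)"
    using z len by (simp add: sum.list_conv_set_nth lessThan_atLeast0)
  show "(\<Prod>i<m. h (zabs q ((vec_of_list es vmod q) $ i))) = (\<Prod>x\<leftarrow>es. h \<bar>x\<bar> :: real)"
    using z len by (simp add: prod.list_conv_set_nth lessThan_atLeast0)
qed

text \<open>The acceptance probability for noise \<open>e\<close>, as found in
  \<open>bob_accept_prob\<close>.\<close>

definition accept_weight :: "nat \<Rightarrow> nat \<Rightarrow> real \<Rightarrow> int vec \<Rightarrow> real" where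
  "accept_weight q m t e = (\<Prod>i<m. 1 - real_of_int (zabs q (e $ i)) / (2 * real_of_int \<lfloor>t\<rfloor> + 1))"

text \<open>Transfers the tilted bound from integer lists to vectors mod q. Positivity, without
  which conditioning would be meaningless, holds because each factor is positive on the
  support.\<close>

lemma tilted_reduced_noise:
  assumes "s \<ge> 1" "0 \<le> t" "4 * t < real q" "m > 0"
  shows "(\<integral>\<^sup>+e. ennreal (real_of_int (\<Sum>i<m. zabs q (e $ i))) * ennreal (accept_weight q m t e)
      \<partial>reduced_noise q m s t)
    \<le> ennreal (2 * real m * s) * (\<integral>\<^sup>+e. ennreal (accept_weight q m t e) \<partial>reduced_noise q m s t)"
    and "(\<integral>\<^sup>+e. ennreal (accept_weight q m t e) \<partial>reduced_noise q m s t) > 0"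
proof -
  let ?M = "2 * real_of_int \<lfloor>t\<rfloor> + 1"
  let ?R = "replicate_pmf m (truncated_gaussian s t)"
  let ?h = "\<lambda>x :: int. ennreal \<bar>real_of_int x\<bar>" and ?w = "\<lambda>x :: int. ennreal (1 - \<bar>real_of_int x\<bar> / ?M)"
  have s: "s > 0" using assms(1) by simp
  have M: "?M > 0" using assms(2) by (simp add: add_nonneg_pos)
  have pos: "1 - \<bar>real_of_int x\<bar> / ?M > 0" if "\<bar>x\<bar> \<le> \<lfloor>t\<rfloor>" for x
  proof -
    have "\<bar>real_of_int x\<bar> \<le> real_of_int \<lfloor>t\<rfloor>" using that by linarith
    then have "\<bar>real_of_int x\<bar> < ?M" using assms(2) by (simp add: add_strict_increasing2)
    then show ?thesis using M by simp
  qed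
  have sum_list_ennreal: "ennreal (real_of_int (\<Sum>x\<leftarrow>es. \<bar>x\<bar>)) = (\<Sum>x\<leftarrow>es. ?h x)" for es
  proof (induction es)
    case (Cons x es)
    have "0 \<le> (\<Sum>x\<leftarrow>es. \<bar>x\<bar>)" by (induction es) auto
    with Cons show ?case by (simp add: ennreal_plus)
  qed simp
  have prod_list_pos: "(\<Prod>x\<leftarrow>es. 1 - \<bar>real_of_int x\<bar> / ?M) > 0" if "\<And>x. x \<in> set es \<Longrightarrow> \<bar>x\<bar> \<le> \<lfloor>t\<rfloor>" for es
    using that by (induction es) (auto intro!: mult_pos_pos pos)
  have prod_list_ennreal: "ennreal (\<Prod>x\<leftarrow>es. 1 - \<bar>real_of_int x\<bar> / ?M) = (\<Prod>x\<leftarrow>es. ?w x)"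
    if "\<And>x. x \<in> set es \<Longrightarrow> \<bar>x\<bar> \<le> \<lfloor>t\<rfloor>" for es
    using that
  proof (induction es)
    case (Cons x es)
    then show ?case using pos[of x] by (simp add: ennreal_mult')
  qed simp
  note sample = reduced_noise_sample[OF _ s assms(2-4)]
  have weight: "accept_weight q m t (vec_of_list es vmod q) = (\<Prod>x\<leftarrow>es. 1 - \<bar>real_of_int x\<bar> / ?M)"
    if "es \<in> set_pmf ?R" for es
    unfolding accept_weight_def
    by (subst sample(3)[OF that, where h = "\<lambda>k. 1 - real_of_int k / ?M"]) simp
  have W: "(\<integral>\<^sup>+e. ennreal (accept_weight q m t e) \<partial>reduced_noise q m s t) = (\<integral>\<^sup>+es. (\<Prod>x\<leftarrow>es. ?w x) \<partial>?R)"
    unfolding reduced_noise_def nn_integral_map_pmf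
    by (intro nn_integral_cong_AE AE_pmfI)
       (use weight sample(4) prod_list_ennreal in \<open>simp add: weight\<close>)
  have "(\<integral>\<^sup>+e. ennreal (real_of_int (\<Sum>i<m. zabs q (e $ i))) * ennreal (accept_weight q m t e)
      \<partial>reduced_noise q m s t) = (\<integral>\<^sup>+es. (\<Sum>x\<leftarrow>es. ?h x) * (\<Prod>x\<leftarrow>es. ?w x) \<partial>?R)"
    unfolding reduced_noise_def nn_integral_map_pmf
  proof (intro nn_integral_cong_AE AE_pmfI)
    fix es assume es: "es \<in> set_pmf ?R"
    show "ennreal (real_of_int (\<Sum>i<m. zabs q ((vec_of_list es vmod q) $ i))) *
        ennreal (accept_weight q m t (vec_of_list es vmod q)) = (\<Sum>x\<leftarrow>es. ?h x) * (\<Prod>x\<leftarrow>es. ?w x)"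
    proof -
      have "ennreal (\<Prod>x\<leftarrow>es. 1 - \<bar>real_of_int x\<bar> / ?M) = (\<Prod>x\<leftarrow>es. ?w x)"
        by (rule prod_list_ennreal) (rule sample(4)[OF es])
      then show ?thesis unfolding weight[OF es] sample(2)[OF es] sum_list_ennreal by simp
    qed
  qed
  also have "\<dots> \<le> of_nat m * ennreal (2 * s) * (\<integral>\<^sup>+es. (\<Prod>x\<leftarrow>es. ?w x) \<partial>?R)"
    by (intro nn_integral_tilted_replicate_pmf tilted_truncated_gaussian assms)
  also have "of_nat m * ennreal (2 * s) = ennreal (2 * real m * s)"
    using s by (simp add: ennreal_of_nat_eq_real_of_nat ennreal_mult'[symmetric] mult_ac)
  finally show "(\<integral>\<^sup>+e. ennreal (real_of_int (\<Sum>i<m. zabs q (e $ i))) * ennreal (accept_weight q m t e)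
      \<partial>reduced_noise q m s t)
    \<le> ennreal (2 * real m * s) * (\<integral>\<^sup>+e. ennreal (accept_weight q m t e) \<partial>reduced_noise q m s t)"
    unfolding W .
  show "(\<integral>\<^sup>+e. ennreal (accept_weight q m t e) \<partial>reduced_noise q m s t) > 0"
  proof (rule ccontr)
    assume "\<not> ?thesis"
    then have "(\<integral>\<^sup>+es. ennreal (accept_weight q m t (vec_of_list es vmod q)) \<partial>?R) = 0"
      by (simp add: reduced_noise_def)
    then have "AE es in ?R. ennreal (accept_weight q m t (vec_of_list es vmod q)) = 0"
      by (subst (asm) nn_integral_0_iff_AE) auto
    moreover obtain es where es: "es \<in> set_pmf ?R" using set_pmf_not_empty by fast
    ultimately have "accept_weight q m t (vec_of_list es vmod q) \<le> 0"
      by (simp add: AE_measure_pmf_iff ennreal_eq_0_iff)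
    moreover have "(\<Prod>x\<leftarrow>es. 1 - \<bar>real_of_int x\<bar> / ?M) > 0"
      by (rule prod_list_pos) (rule sample(4)[OF es])
    ultimately show False using weight[OF es] by simp
  qed
qed

text \<open>Conditioning divides by the probability of \<open>S\<close>, so an unnormalized bound is
  enough. With \<open>0 <= c\<close> no integrability is required, as the Bochner integral defaults
  to 0.\<close>

lemma expectation_cond_pmf_le:
  fixes p :: "'a pmf"
  assumes "(\<integral>\<^sup>+x. ennreal (f x) * indicator S x \<partial>p) \<le> ennreal c * emeasure (measure_pmf p) S"
    and "emeasure (measure_pmf p) S > 0" "0 \<le> c"
  shows "measure_pmf.expectation (cond_pmf p S) f \<le> c"
proof (rule integral_real_bounded[OF assms(3)])
  have ne: "set_pmf p \<inter> S \<noteq> {}"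
    using assms(2) by (simp add: measure_pmf.emeasure_eq_measure measure_pmf_zero_iff[symmetric] less_le)
  have "(\<integral>\<^sup>+x. ennreal (f x) \<partial>cond_pmf p S) = (\<integral>\<^sup>+x. ennreal (f x) * indicator S x \<partial>p) / emeasure p S"
    unfolding cond_pmf.rep_eq[OF ne] by (rule nn_integral_uniform_measure) auto
  also have "\<dots> \<le> ennreal c * emeasure p S / emeasure p S"
    by (rule divide_right_mono_ennreal) (rule assms(1))
  also have "\<dots> = ennreal c"
    using assms(2) by (intro ennreal_mult_divide_eq) (auto simp: measure_pmf.emeasure_eq_measure)
  finally show "(\<integral>\<^sup>+x. ennreal (f x) \<partial>cond_pmf p S) \<le> ennreal c" .
qed

section \<open>Averaging over the whole protocol\<close>

lemma nn_integral_mono_pmf: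
  assumes "\<And>x. x \<in> set_pmf p \<Longrightarrow> f x \<le> g x"
  shows "(\<integral>\<^sup>+x. f x \<partial>measure_pmf p) \<le> (\<integral>\<^sup>+x. g x \<partial>measure_pmf p)"
  using assms by (intro nn_integral_mono_AE) (auto simp: AE_measure_pmf_iff)

lemma nn_integral_cong_pmf:
  assumes "\<And>x. x \<in> set_pmf p \<Longrightarrow> f x = g x"
  shows "(\<integral>\<^sup>+x. f x \<partial>measure_pmf p) = (\<integral>\<^sup>+x. g x \<partial>measure_pmf p)"
  using assms by (intro nn_integral_cong_AE) (auto simp: AE_measure_pmf_iff)

text \<open>Bob's randomness stands innermost, so his acceptance probability can be evaluated with
  \<open>e\<close> fixed.\<close>

lemma nn_integral_protocol_P:
  "(\<integral>\<^sup>+z. F z \<partial>protocol_P q Q n m \<sigma> \<tau> gentrap \<alpha>) =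
    (\<integral>\<^sup>+(A, t). \<integral>\<^sup>+s. \<integral>\<^sup>+e. \<integral>\<^sup>+f. \<integral>\<^sup>+(y, u, \<beta>). F (A, t, s, e, f, y, u, \<beta>)
      \<partial>bob q Q n m \<tau> A ((A *\<^sub>v s + e) vmod q) ((transpose_mat A *\<^sub>v f) vmod q)
        ((f \<bullet> ((A *\<^sub>v s + e) vmod q) + \<alpha>) mod int q)
      \<partial>pmf_of_set (Zvec 2 m) \<partial>reduced_noise q m \<sigma> \<tau> \<partial>pmf_of_set (Zvec q n) \<partial>gentrap)"
  unfolding protocol_P_def reduced_noise_def[symmetric]
  by (simp add: case_prod_beta' Let_def)

text \<open>The claim at one value of the security parameter. Once Bob's outcomes are integrated
  out, only the law of \<open>e\<close> matters, and the tilted noise bound applies.\<close>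

lemma expected_trace_distance_le:
  fixes q Q n m :: nat and \<sigma> \<tau> :: real
  assumes q: "1 < q" "Q = nat \<lceil>log 2 (real q)\<rceil>" and n: "n \<ge> 1" and m: "m = n * (2 * Q + 1)"
    and \<tau>: "\<tau> = real q / (4 * real m * real Q)" and \<sigma>: "\<sigma> \<ge> 1"
    and A: "\<And>A t. (A, t) \<in> set_pmf gentrap \<Longrightarrow> A \<in> Zmat q m n"
    and invert: "\<And>A t s e. (A, t) \<in> set_pmf gentrap \<Longrightarrow> s \<in> Zvec q n \<Longrightarrow>
       e \<in> short_vecs q m (2 * \<tau>) \<Longrightarrow> invert A ((A *\<^sub>v s + e) vmod q) t = s"
  shows "measure_pmf.expectation (cond_pmf (protocol_P q Q n m \<sigma> \<tau> gentrap \<alpha>) (no_abort q n m \<tau>))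
      (\<lambda>(A, t, s, e, f, y, u, \<beta>).
         trace_norm (ketbra (alice_ket q \<alpha> (alice_bit q Q invert A t s y u)) - ketbra \<beta>))
    \<le> 4 * pi * real m * \<sigma> / real q"
proof (rule expectation_cond_pmf_le)
  have lq: "log 2 (real q) > 0" using q(1) by simp
  have Q: "Q \<ge> 1" using lq q(2) by linarith
  \<comment> \<open>Together with \<open>Q >= 1\<close> this gives
    \<open>4 * \<tau> = q / (m * Q) <= q / 3\<close>, the source of the no-wraparound bound.\<close>
  have m3: "m \<ge> 3" using n Q m mult_le_mono[of 1 n 3 "2 * Q + 1"] by linarith
  have q_le: "q \<le> 2 ^ Q"
  proof -
    have "log 2 (real q) \<le> real Q" using q(2) lq by linarith
    then have "real q \<le> 2 powr real Q" using q(1) by (simp add: log_le_iff)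
    then have "real q \<le> real (2 ^ Q)" by (simp add: powr_realpow)
    then show ?thesis by (simp only: of_nat_le_iff)
  qed
  have \<tau>_bounds: "0 \<le> \<tau>" "4 * \<tau> < real q"
  proof -
    have "real m * real Q \<ge> 3 * 1" using m3 Q by (intro mult_mono) auto
    then have "real q / (real m * real Q) \<le> real q / 3"
      using divide_left_mono[of "3 * 1" "real m * real Q" "real q"] by simp
    also have "\<dots> < real q" using q(1) by simp
    finally show "4 * \<tau> < real q" by (simp add: \<tau>)
  qed (simp add: \<tau>)
  have lwe: "lwe_matrix q Q n m \<tau> A (\<lambda>y. invert A y t)" if "(A, t) \<in> set_pmf gentrap" for A t
    using that q(1) q_le m3 \<tau>_bounds A invert by unfold_locales auto
  let ?P = "protocol_P q Q n m \<sigma> \<tau> gentrap \<alpha>" and ?NA = "no_abort q n m \<tau>"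
  let ?W = "\<lambda>e. ennreal (accept_weight q m \<tau> e)"
  let ?IW = "\<integral>\<^sup>+e. ?W e \<partial>reduced_noise q m \<sigma> \<tau>"
  let ?D = "\<lambda>A t s y u \<beta>. trace_norm (ketbra (alice_ket q \<alpha> (alice_bit q Q invert A t s y u)) - ketbra \<beta>)"
  let ?F = "\<lambda>(A, t, s, e, f, y, u, \<beta>). ?D A t s y u \<beta>"
  let ?bob = "\<lambda>A s e f. bob q Q n m \<tau> A ((A *\<^sub>v s + e) vmod q) ((transpose_mat A *\<^sub>v f) vmod q)
        ((f \<bullet> ((A *\<^sub>v s + e) vmod q) + \<alpha>) mod int q)"
  let ?acc = "\<lambda>A s e. {(y, u, \<beta>). alice_no_abort q n m \<tau> A ((A *\<^sub>v s + e) vmod q) y}"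
  let ?H = "\<lambda>e. ennreal (2 * pi / real q * real_of_int (\<Sum>i<m. zabs q (e $ i)))"
  have short: "e \<in> short_vecs q m \<tau>" if "e \<in> set_pmf (reduced_noise q m \<sigma> \<tau>)" for e
    using that reduced_noise_sample(1)[of _ m \<sigma> \<tau> q] \<sigma> \<tau>_bounds m3 by (auto simp: reduced_noise_def)
  have Zs: "set_pmf (pmf_of_set (Zvec q' d)) = Zvec q' d" if "q' > 0" for q' d
    using that by (simp add: Zvec_nonempty finite_Zvec)
  have acc_prob: "(\<integral>\<^sup>+(y, u, \<beta>). indicator ?NA (A, t, s, e, f, y, u, \<beta>) \<partial>?bob A s e f) = ?W e"
    if "(A, t) \<in> set_pmf gentrap" "s \<in> Zvec q n" "e \<in> set_pmf (reduced_noise q m \<sigma> \<tau>)" for A t s e f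
  proof -
    have "(\<lambda>(y, u, \<beta>). indicator ?NA (A, t, s, e, f, y, u, \<beta>) :: ennreal) = indicator (?acc A s e)"
      by (auto simp: no_abort_def indicator_def fun_eq_iff)
    then show ?thesis
      using lwe_matrix.bob_accept_prob[OF lwe[OF that(1)] that(2) short[OF that(3)]]
      by (simp add: accept_weight_def)
  qed
  \<comment> \<open>For fixed \<open>A\<close>, \<open>s\<close>, \<open>e\<close>, \<open>f\<close>
    the error bound is constant on accepted outcomes, so it factors out and leaves the acceptance
    probability.\<close>
  have err: "(\<integral>\<^sup>+(y, u, \<beta>). ennreal (?D A t s y u \<beta>) * indicator ?NA (A, t, s, e, f, y, u, \<beta>)
      \<partial>?bob A s e f) \<le> ?H e * ?W e"
    if At: "(A, t) \<in> set_pmf gentrap" and s: "s \<in> Zvec q n"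
      and e: "e \<in> set_pmf (reduced_noise q m \<sigma> \<tau>)" and f: "f \<in> Zvec 2 m" for A t s e f
  proof -
    have "(\<integral>\<^sup>+(y, u, \<beta>). ennreal (?D A t s y u \<beta>) * indicator ?NA (A, t, s, e, f, y, u, \<beta>) \<partial>?bob A s e f)
      \<le> (\<integral>\<^sup>+(y, u, \<beta>). ?H e * indicator ?NA (A, t, s, e, f, y, u, \<beta>) \<partial>?bob A s e f)"
    proof (rule nn_integral_mono_pmf, clarify)
      fix y u \<beta> assume out: "(y, u, \<beta>) \<in> set_pmf (?bob A s e f)"
      show "ennreal (?D A t s y u \<beta>) * indicator ?NA (A, t, s, e, f, y, u, \<beta>)
        \<le> ?H e * indicator ?NA (A, t, s, e, f, y, u, \<beta>)"
      proof (cases "alice_no_abort q n m \<tau> A ((A *\<^sub>v s + e) vmod q) y")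
        case True
        have "?D A t s y u \<beta> \<le> 2 * pi / real q * real_of_int (\<Sum>i<m. zabs q (e $ i))"
          using lwe_matrix.trace_distance_le[OF lwe[OF At] s short[OF e] f out True refl]
          by (simp add: alice_bit_def Let_def)
        then show ?thesis by (intro mult_right_mono ennreal_leI) auto
      next
        case False
        then show ?thesis by (simp add: no_abort_def)
      qed
    qed
    also have "\<dots> = ?H e * (\<integral>\<^sup>+(y, u, \<beta>). indicator ?NA (A, t, s, e, f, y, u, \<beta>) \<partial>?bob A s e f)"
      unfolding case_prod_beta' by (rule nn_integral_cmult) simp
    finally show ?thesis unfolding acc_prob[OF At s e] .
  qed
  have P_NA: "emeasure (measure_pmf ?P) ?NA = ?IW"
  proof -
    have "emeasure (measure_pmf ?P) ?NA = (\<integral>\<^sup>+z. indicator ?NA z \<partial>?P)" by simp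
    also have "\<dots> = (\<integral>\<^sup>+At. \<integral>\<^sup>+s. \<integral>\<^sup>+e. \<integral>\<^sup>+(f :: int vec). ?W e
      \<partial>pmf_of_set (Zvec 2 m) \<partial>reduced_noise q m \<sigma> \<tau> \<partial>pmf_of_set (Zvec q n) \<partial>gentrap)"
      unfolding nn_integral_protocol_P
    proof (rule nn_integral_cong_pmf, clarify)
      fix A t assume At: "(A, t) \<in> set_pmf gentrap"
      show "(\<integral>\<^sup>+s. \<integral>\<^sup>+e. \<integral>\<^sup>+f. \<integral>\<^sup>+(y, u, \<beta>). indicator ?NA (A, t, s, e, f, y, u, \<beta>) \<partial>?bob A s e f
         \<partial>pmf_of_set (Zvec 2 m) \<partial>reduced_noise q m \<sigma> \<tau> \<partial>pmf_of_set (Zvec q n))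
        = (\<integral>\<^sup>+s. \<integral>\<^sup>+e. \<integral>\<^sup>+(f :: int vec). ?W e
      \<partial>pmf_of_set (Zvec 2 m) \<partial>reduced_noise q m \<sigma> \<tau> \<partial>pmf_of_set (Zvec q n))"
        using q(1) by (intro nn_integral_cong_pmf acc_prob At) (simp_all add: Zs)
    qed
    finally show ?thesis by simp
  qed
  show "emeasure (measure_pmf ?P) ?NA > 0"
    unfolding P_NA using \<sigma> \<tau>_bounds m3 by (intro tilted_reduced_noise) auto
  show "0 \<le> 4 * pi * real m * \<sigma> / real q" using \<sigma> by simp
  have "(\<integral>\<^sup>+z. ennreal (?F z) * indicator ?NA z \<partial>?P) \<le>
    (\<integral>\<^sup>+At. \<integral>\<^sup>+s. \<integral>\<^sup>+e. \<integral>\<^sup>+(f :: int vec). ?H e * ?W e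
      \<partial>pmf_of_set (Zvec 2 m) \<partial>reduced_noise q m \<sigma> \<tau> \<partial>pmf_of_set (Zvec q n) \<partial>gentrap)"
    unfolding nn_integral_protocol_P
  proof (rule nn_integral_mono_pmf, clarify)
    fix A t assume At: "(A, t) \<in> set_pmf gentrap"
    show "(\<integral>\<^sup>+s. \<integral>\<^sup>+e. \<integral>\<^sup>+f. \<integral>\<^sup>+(y, u, \<beta>).
          ennreal (?D A t s y u \<beta>) * indicator ?NA (A, t, s, e, f, y, u, \<beta>) \<partial>?bob A s e f
         \<partial>pmf_of_set (Zvec 2 m) \<partial>reduced_noise q m \<sigma> \<tau> \<partial>pmf_of_set (Zvec q n))
        \<le> (\<integral>\<^sup>+s. \<integral>\<^sup>+e. \<integral>\<^sup>+(f :: int vec). ?H e * ?W e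
      \<partial>pmf_of_set (Zvec 2 m) \<partial>reduced_noise q m \<sigma> \<tau> \<partial>pmf_of_set (Zvec q n))"
      using q(1) by (intro nn_integral_mono_pmf err At) (simp_all add: Zs)
  qed
  also have "\<dots> = (\<integral>\<^sup>+e. ennreal (2 * pi / real q) *
      (ennreal (real_of_int (\<Sum>i<m. zabs q (e $ i))) * ?W e) \<partial>reduced_noise q m \<sigma> \<tau>)"
  proof -
    have "?H e = ennreal (2 * pi / real q) * ennreal (real_of_int (\<Sum>i<m. zabs q (e $ i)))" for e
      by (rule ennreal_mult') simp
    then show ?thesis by (simp only: mult.assoc) simp
  qed
  also have "\<dots> = ennreal (2 * pi / real q) *
      (\<integral>\<^sup>+e. ennreal (real_of_int (\<Sum>i<m. zabs q (e $ i))) * ?W e \<partial>reduced_noise q m \<sigma> \<tau>)"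
    by (rule nn_integral_cmult) simp
  \<comment> \<open>An angle of \<open>2 pi / q\<close> per unit of noise times
    \<open>2 m \<sigma>\<close> for the tilted total noise yields the constant.\<close>
  also have "\<dots> \<le> ennreal (2 * pi / real q) * (ennreal (2 * real m * \<sigma>) * ?IW)"
    using \<sigma> \<tau>_bounds m3 by (intro mult_left_mono tilted_reduced_noise) auto
  also have "\<dots> = ennreal (4 * pi * real m * \<sigma> / real q) * emeasure (measure_pmf ?P) ?NA"
    using \<sigma> unfolding P_NA mult.assoc[symmetric] by (subst ennreal_mult[symmetric]) (auto simp: mult_ac)
  finally show "(\<integral>\<^sup>+z. ennreal (?F z) * indicator ?NA z \<partial>?P)
    \<le> ennreal (4 * pi * real m * \<sigma> / real q) * emeasure (measure_pmf ?P) ?NA" .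
qed

theorem theorem6p2:
  fixes q Q n m :: "nat \<Rightarrow> nat"
    and \<sigma> \<tau> :: "nat \<Rightarrow> real"
    and GenTrap :: "nat \<Rightarrow> (int mat \<times> 't) pmf"
    and Invert :: "nat \<Rightarrow> int mat \<Rightarrow> int vec \<Rightarrow> 't \<Rightarrow> int vec"
    and l :: nat and \<alpha> :: int
  assumes "poly_bounded (\<lambda>l. log 2 (real (q l)))"
    and "poly_bounded (\<lambda>l. log 2 (\<sigma> l))"
    and "\<And>l. l \<ge> 1 \<Longrightarrow> \<sigma> l \<ge> 1"
    and "\<And>l. l \<ge> 1 \<Longrightarrow> prime (q l) \<and> odd (q l)"
    and "\<And>l. l \<ge> 1 \<Longrightarrow> Q l = nat \<lceil>log 2 (real (q l))\<rceil>"
    and "\<And>l. l \<ge> 1 \<Longrightarrow> n l = l"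
    and "\<And>l. l \<ge> 1 \<Longrightarrow> m l = n l * (2 * Q l + 1)"
    and "\<And>l. l \<ge> 1 \<Longrightarrow> \<tau> l = real (q l) / (4 * real (m l) * real (Q l))"
    and "\<And>l. l \<ge> 1 \<Longrightarrow> \<tau> l \<ge> 2 * real (m l) * \<sigma> l"
    and "\<And>l A t. l \<ge> 1 \<Longrightarrow> (A, t) \<in> set_pmf (GenTrap l) \<Longrightarrow> A \<in> Zmat (q l) (m l) (n l)"
    and "\<And>l. l \<ge> 1 \<Longrightarrow>
           stat_dist (map_pmf fst (GenTrap l)) (pmf_of_set (Zmat (q l) (m l) (n l)))
             \<le> real (n l) * real (Q l) * 2 powr (- real (n l) / 2)"
    and "\<And>l A t s e. l \<ge> 1 \<Longrightarrow> (A, t) \<in> set_pmf (GenTrap l) \<Longrightarrow>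
           s \<in> Zvec (q l) (n l) \<Longrightarrow> e \<in> short_vecs (q l) (m l) (2 * \<tau> l) \<Longrightarrow>
           Invert l A ((A *\<^sub>v s + e) vmod q l) t = s"
    and "l \<ge> 1"
    and "\<alpha> \<in> {0..<int (q l)}"
  shows "measure_pmf.expectation
           (cond_pmf (protocol_P (q l) (Q l) (n l) (m l) (\<sigma> l) (\<tau> l) (GenTrap l) \<alpha>)
              (no_abort (q l) (n l) (m l) (\<tau> l)))
           (\<lambda>(A, t, s, e, f, y, u, \<beta>).
              trace_norm
                (ketbra (alice_ket (q l) \<alpha> (alice_bit (q l) (Q l) (Invert l) A t s y u))
                 - ketbra \<beta>))
         \<le> 4 * pi * real (m l) * \<sigma> l / real (q l)"
proof (rule expected_trace_distance_le)
  have "prime (q l)" "odd (q l)" using assms(4)[OF \<open>l \<ge> 1\<close>] by auto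
  then show "1 < q l" using prime_gt_1_nat by blast
qed (use assms \<open>l \<ge> 1\<close> in auto)

end
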